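(* There exist a symbolic space $X=\mathcal A^{\mathbb N}$ ($\mathcal A$ a finite alphabet) and a computable map $T:X\to X$ with a $\Sigma_2$-complete statistical attractor $A\subset X$, where the reference measure is any shift-ergodic probability measure of full support on $X$.
   Context: **Symbolic space.** On $X=\mathcal A^{\mathbb N}$, $\mathcal A$ a finite alphabet, the distance is $d(x,y)=2^{-\min\{n:x_n\ne y_n\}}$; the ideal points are the eventually constant sequences $w0^\infty$, $w\in\mathcal A^*$ (with $0\in\mathcal A$ a fixed letter). The ideal balls are the open balls with ideal center and positive rational radius (they are cylinders); $(B_i)_{i\in\mathbb N}$ is a fixed computable enumeration of them. A map $T:X\to X$ is computable iff there are a non-decreasing computable function $\varphi:\mathbb N\to\mathbb N$ and an algorithm which, given the first $\varphi(n)$ symbols of $x$, computes the first $n$ symbols of $T(x)$. The shift is $\sigma(x)_i=x_{i+1}$. A measure is shift-ergodic if it is a $\sigma$-invariant and $\sigma$-ergodic Borel probability measure. **Complexity of closed sets.** A compact set $K$ is $\Sigma_n$ if its inner collection $\{i:B_i\cap K\neq\emptyset\}$ is a $\Sigma_n$ set of integers (arithmetical hierarchy). $K$ is $\Sigma_n$-complete if it is $\Sigma_n$ and any other $\Sigma_n$ compact set $K'$ can be reduced to $K$, in the sense that, provided with an enumeration of the inner collection of $K$, we can (algorithmically) enumerate the inner collection of $K'$. **Statistical attractor.** $\nu_x$ denotes the weak* limit of $\frac1n\sum_{i<n}\delta_{T^i(x)}$ when it exists. A closed set $A$ is a statistical attractor (with respect to a reference measure $\lambda$) if there is a unique $T$-invariant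 probability measure $\mu$ such that $\mathrm{supp}(\mu)=A$ and $\nu_x=\mu$ for $\lambda$-almost every $x$. *)

theory Defs
  imports "HOL-Probability.Probability" "HOL-Library.Nat_Bijection"
begin

section \<open>Computability on the natural numbers\<close>

text \<open>
  Kleene's partial recursive functions, in one argument: several arguments are packed into one
  by the Cantor pairing function. Since pairing and both projections are among the basic
  functions, this yields the usual class.
\<close>

definition pair_pfun :: "(nat \<Rightarrow> nat option) \<Rightarrow> (nat \<Rightarrow> nat option) \<Rightarrow> nat \<Rightarrow> nat option" where
  "pair_pfun f g n =
     Option.bind (f n) (\<lambda>a. Option.bind (g n) (\<lambda>b. Some (prod_encode (a, b))))"

definition prim_rec_pfun :: "(nat \<Rightarrow> nat option) \<Rightarrow> (nat \<Rightarrow> nat option) \<Rightarrow> nat \<Rightarrow> nat option" where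
  "prim_rec_pfun f g n =
     (case prod_decode n of (a, m) \<Rightarrow>
        rec_nat (f a) (\<lambda>i v. Option.bind v (\<lambda>r. g (prod_encode (a, prod_encode (i, r))))) m)"

definition is_first_zero :: "(nat \<Rightarrow> nat option) \<Rightarrow> nat \<Rightarrow> nat \<Rightarrow> bool" where
  "is_first_zero f a m \<longleftrightarrow>
     f (prod_encode (a, m)) = Some 0 \<and> (\<forall>j<m. \<exists>v>0. f (prod_encode (a, j)) = Some v)"

definition minimize_pfun :: "(nat \<Rightarrow> nat option) \<Rightarrow> nat \<Rightarrow> nat option" where
  "minimize_pfun f a =
     (if \<exists>m. is_first_zero f a m then Some (THE m. is_first_zero f a m) else None)"

inductive partial_recursive :: "(nat \<Rightarrow> nat option) \<Rightarrow> bool" where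
  zero: "partial_recursive (\<lambda>n. Some 0)"
| succ: "partial_recursive (\<lambda>n. Some (Suc n))"
| left: "partial_recursive (\<lambda>n. Some (fst (prod_decode n)))"
| right: "partial_recursive (\<lambda>n. Some (snd (prod_decode n)))"
| pair: "partial_recursive f \<Longrightarrow> partial_recursive g \<Longrightarrow> partial_recursive (pair_pfun f g)"
| comp: "partial_recursive f \<Longrightarrow> partial_recursive g \<Longrightarrow>
          partial_recursive (\<lambda>n. Option.bind (g n) f)"
| prim_rec: "partial_recursive f \<Longrightarrow> partial_recursive g \<Longrightarrow> partial_recursive (prim_rec_pfun f g)"
| minimize: "partial_recursive f \<Longrightarrow> partial_recursive (minimize_pfun f)"

definition computable :: "(nat \<Rightarrow> nat) \<Rightarrow> bool" where
  "computable f \<longleftrightarrow> partial_recursive (\<lambda>n. Some (f n))"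

definition decidable :: "nat set \<Rightarrow> bool" where
  "decidable S \<longleftrightarrow> computable (\<lambda>n. if n \<in> S then 1 else 0)"

text \<open>
  The arithmetical hierarchy. In the successor case the complement of \<open>R\<close> is the
  generic \<open>\<Pi>\<^sub>n\<close> set.
\<close>

fun Sigma_set :: "nat \<Rightarrow> nat set \<Rightarrow> bool" where
  "Sigma_set 0 S \<longleftrightarrow> decidable S"
| "Sigma_set (Suc n) S \<longleftrightarrow> (\<exists>R. Sigma_set n R \<and> S = {x. \<exists>y. prod_encode (x, y) \<notin> R})"

text \<open>
  An enumeration outputs the element \<open>a\<close> at stage \<open>t\<close> if its value is \<open>Suc a\<close>, and outputs
  nothing at that stage if its value is \<open>0\<close>, so that the empty set can be enumerated too.
\<close>

definition enumerates :: "(nat \<Rightarrow> nat) \<Rightarrow> nat set \<Rightarrow> bool" where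
  "enumerates f S \<longleftrightarrow> S = {a. \<exists>t. f t = Suc a}"

text \<open>
  A single algorithm \<open>h\<close> turns every enumeration \<open>f\<close> of \<open>S\<close> into an enumeration of \<open>S'\<close>:
  its output at stage \<open>t\<close> is computed from the first \<open>t\<close> values of \<open>f\<close>.
\<close>

definition enumeration_reducible :: "nat set \<Rightarrow> nat set \<Rightarrow> bool" where
  "enumeration_reducible S' S \<longleftrightarrow>
     (\<exists>h. computable h \<and>
        (\<forall>f. enumerates f S \<longrightarrow> enumerates (\<lambda>t. h (list_encode (map f [0..<t]))) S'))"


section \<open>Symbolic spaces\<close>

text \<open>The alphabet with \<open>k\<close> letters is \<open>{..<k}\<close>; its distinguished letter is \<open>0\<close>.\<close>

definition symb_space :: "nat \<Rightarrow> (nat \<Rightarrow> nat) set" where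
  "symb_space k = {x. \<forall>n. x n < k}"

definition symb_dist :: "(nat \<Rightarrow> nat) \<Rightarrow> (nat \<Rightarrow> nat) \<Rightarrow> real" where
  "symb_dist x y = (if x = y then 0 else inverse (2 ^ (LEAST n. x n \<noteq> y n)))"

lemma symb_dist_nonneg: "0 \<le> symb_dist x y"
  unfolding symb_dist_def by simp

lemma symb_dist_self: "symb_dist x x = 0"
  unfolding symb_dist_def by simp

lemma symb_dist_commute: "symb_dist x y = symb_dist y x"
proof -
  have "(\<lambda>n. x n \<noteq> y n) = (\<lambda>n. y n \<noteq> x n)"
    by (intro ext) (rule neq_commute)
  then show ?thesis
    unfolding symb_dist_def by (simp only: eq_commute[of x y])
qed

lemma symb_dist_triangle: "symb_dist x z \<le> symb_dist x y + symb_dist y z"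
proof -
  consider "x = y" | "y = z" | "x = z" | "x \<noteq> y" "y \<noteq> z" "x \<noteq> z"
    by blast
  then show ?thesis
  proof cases
    case 4
    let ?l = "LEAST n. x n \<noteq> z n"
    have "\<exists>n. x n \<noteq> z n"
      using \<open>x \<noteq> z\<close> by blast
    then have "x ?l \<noteq> z ?l"
      by (rule LeastI_ex)
    then have "x ?l \<noteq> y ?l \<or> y ?l \<noteq> z ?l"
      by argo
    then have "(LEAST n. x n \<noteq> y n) \<le> ?l \<or> (LEAST n. y n \<noteq> z n) \<le> ?l"
      by (elim disjE) (simp_all only: Least_le simp_thms)
    moreover have "inverse (2 ^ b) \<le> (inverse (2 ^ a) :: real)" if "a \<le> b" for a b :: nat
      using that by (simp add: power_increasing le_imp_inverse_le)
    ultimately have "symb_dist x z \<le> symb_dist x y \<or> symb_dist x z \<le> symb_dist y z"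
      unfolding symb_dist_def if_not_P[OF 4(1)] if_not_P[OF 4(2)] if_not_P[OF 4(3)] by blast
    then show ?thesis
      using symb_dist_nonneg[of x y] symb_dist_nonneg[of y z] by linarith
  qed (simp_all only: symb_dist_self symb_dist_nonneg add_0_left add_0_right order_refl add_nonneg_nonneg)
qed

lemma Metric_space_symb_space: "Metric_space (symb_space k) symb_dist"
proof
  show "symb_dist x y = 0 \<longleftrightarrow> x = y" for x y
    unfolding symb_dist_def by simp
qed (rule symb_dist_nonneg symb_dist_commute symb_dist_triangle)+

definition symb_topology :: "nat \<Rightarrow> (nat \<Rightarrow> nat) topology" where
  "symb_topology k = Metric_space.mtopology (symb_space k) symb_dist"

definition shift :: "(nat \<Rightarrow> nat) \<Rightarrow> nat \<Rightarrow> nat" where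
  "shift x = (\<lambda>i. x (Suc i))"

definition ideal_point :: "nat list \<Rightarrow> nat \<Rightarrow> nat" where
  "ideal_point w = (\<lambda>n. if n < length w then w ! n else 0)"

text \<open>
  The enumeration of the ideal balls: the index codes a list, which reduced modulo \<open>k\<close>
  gives an arbitrary word \<open>w\<close>, and the numbers \<open>p\<close> and \<open>q\<close> of the radius
  \<open>(p + 1) / (q + 1)\<close>.
\<close>

definition ideal_ball :: "nat \<Rightarrow> nat \<Rightarrow> (nat \<Rightarrow> nat) set" where
  "ideal_ball k i =
     (case prod_decode i of (a, b) \<Rightarrow> case prod_decode b of (p, q) \<Rightarrow>
        Metric_space.mball (symb_space k) symb_dist
          (ideal_point (map (\<lambda>m. m mod k) (list_decode a)))
          (real (Suc p) / real (Suc q)))"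

text \<open>
  The algorithm \<open>h\<close> is given \<open>n\<close> and the first \<open>\<phi> n\<close> symbols of \<open>x\<close>; nothing is required of
  it on other inputs.
\<close>

definition computable_map :: "nat \<Rightarrow> ((nat \<Rightarrow> nat) \<Rightarrow> nat \<Rightarrow> nat) \<Rightarrow> bool" where
  "computable_map k T \<longleftrightarrow>
     T \<in> symb_space k \<rightarrow> symb_space k \<and>
     (\<exists>\<phi> h. mono \<phi> \<and> computable \<phi> \<and> partial_recursive h \<and>
        (\<forall>x\<in>symb_space k. \<forall>n.
           h (prod_encode (n, list_encode (map x [0..<\<phi> n])))
             = Some (list_encode (map (T x) [0..<n]))))"


section \<open>Complexity of compact sets\<close>

definition inner_collection :: "nat \<Rightarrow> (nat \<Rightarrow> nat) set \<Rightarrow> nat set" where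
  "inner_collection k K = {i. ideal_ball k i \<inter> K \<noteq> {}}"

definition Sigma_compact :: "nat \<Rightarrow> nat \<Rightarrow> (nat \<Rightarrow> nat) set \<Rightarrow> bool" where
  "Sigma_compact n k K \<longleftrightarrow>
     compactin (symb_topology k) K \<and> Sigma_set n (inner_collection k K)"

definition Sigma_complete :: "nat \<Rightarrow> nat \<Rightarrow> (nat \<Rightarrow> nat) set \<Rightarrow> bool" where
  "Sigma_complete n k K \<longleftrightarrow>
     Sigma_compact n k K \<and>
     (\<forall>K'. Sigma_compact n k K' \<longrightarrow>
        enumeration_reducible (inner_collection k K') (inner_collection k K))"


section \<open>Measures and statistical attractors\<close>

definition symb_borel :: "nat \<Rightarrow> (nat \<Rightarrow> nat) measure" where
  "symb_borel k = sigma (symb_space k) {U. openin (symb_topology k) U}"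

definition borel_prob :: "nat \<Rightarrow> (nat \<Rightarrow> nat) measure \<Rightarrow> bool" where
  "borel_prob k \<mu> \<longleftrightarrow> prob_space \<mu> \<and> sets \<mu> = sets (symb_borel k)"

definition invariant_measure :: "('a \<Rightarrow> 'a) \<Rightarrow> 'a measure \<Rightarrow> bool" where
  "invariant_measure T \<mu> \<longleftrightarrow> T \<in> measurable \<mu> \<mu> \<and> distr \<mu> \<mu> T = \<mu>"

definition ergodic_measure :: "('a \<Rightarrow> 'a) \<Rightarrow> 'a measure \<Rightarrow> bool" where
  "ergodic_measure T \<mu> \<longleftrightarrow>
     invariant_measure T \<mu> \<and>
     (\<forall>E\<in>sets \<mu>. T -` E \<inter> space \<mu> = E \<longrightarrow> measure \<mu> E = 0 \<or> measure \<mu> E = 1)"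

definition shift_ergodic :: "nat \<Rightarrow> (nat \<Rightarrow> nat) measure \<Rightarrow> bool" where
  "shift_ergodic k \<mu> \<longleftrightarrow> borel_prob k \<mu> \<and> ergodic_measure shift \<mu>"

definition measure_support :: "'a topology \<Rightarrow> 'a measure \<Rightarrow> 'a set" where
  "measure_support X \<mu> =
     {x \<in> topspace X. \<forall>U. openin X U \<and> x \<in> U \<longrightarrow> 0 < emeasure \<mu> U}"

definition weak_star_limit :: "'a topology \<Rightarrow> (nat \<Rightarrow> 'a measure) \<Rightarrow> 'a measure \<Rightarrow> bool" where
  "weak_star_limit X \<mu>s \<mu> \<longleftrightarrow>
     (\<forall>f :: 'a \<Rightarrow> real. continuous_map X euclideanreal f \<longrightarrow>
        (\<lambda>n. integral\<^sup>L (\<mu>s n) f) \<longlonglongrightarrow> integral\<^sup>L \<mu> f)"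

text \<open>
  The average of the Dirac measures at the first \<open>n\<close> points of the orbit of \<open>x\<close>, as the image
  of the uniform distribution on \<open>{..<n}\<close>; only \<open>n > 0\<close> is relevant.
\<close>

definition empirical_measure ::
  "nat \<Rightarrow> ((nat \<Rightarrow> nat) \<Rightarrow> nat \<Rightarrow> nat) \<Rightarrow> (nat \<Rightarrow> nat) \<Rightarrow> nat \<Rightarrow> (nat \<Rightarrow> nat) measure" where
  "empirical_measure k T x n =
     distr (uniform_count_measure {..<n}) (symb_borel k) (\<lambda>i. (T ^^ i) x)"

definition statistical_attractor ::
  "nat \<Rightarrow> ((nat \<Rightarrow> nat) \<Rightarrow> nat \<Rightarrow> nat) \<Rightarrow> (nat \<Rightarrow> nat) measure \<Rightarrow> (nat \<Rightarrow> nat) set \<Rightarrow> bool" where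
  "statistical_attractor k T m A \<longleftrightarrow>
     closedin (symb_topology k) A \<and>
     (\<exists>!\<mu>. borel_prob k \<mu> \<and> invariant_measure T \<mu> \<and>
        measure_support (symb_topology k) \<mu> = A \<and>
        (AE x in m. weak_star_limit (symb_topology k) (empirical_measure k T x) \<mu>))"

end

theory Submission
  imports Defs
begin

text \<open>
  There are four letters. A point starting with \<open>3 2\<^sup>p 0\<close> is a counter showing \<open>p\<close>; its
  image is \<open>2\<^sup>p u 3 2\<^sup>p\<^sup>+\<^sup>1 0\<^sup>\<infinity>\<close>, where \<open>u\<close> is a long prefix of a point \<open>0\<^sup>j 1 0\<^sup>\<infinity>\<close> or \<open>0\<^sup>\<infinity>\<close>
  that depends on \<open>p\<close>. The leading letters 2 make the map continuous where \<open>p\<close> tends to infinity.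
  They are shifted out one by one; then the symbol in front of the first 3 is deleted repeatedly,
  until the counter, now showing \<open>p + 1\<close>, is in front. Meanwhile the orbit stays close to the
  point approximated by \<open>u\<close>, which is fixed, as all points over \<open>{0, 1}\<close> are. The statistics of
  the orbit is therefore a mixture of point masses.

  The lengths of the words \<open>u\<close> give weight \<open>2\<^sup>-\<^sup>e\<^sup>-\<^sup>1\<close> to the \<open>e\<close>-th guess. The guess
  \<open>e = ((c, x), y)\<close> is the point with its 1 at position \<open>j = (c, x)\<close> as long as the program \<open>c\<close>
  has not been seen to halt on \<open>(x, y)\<close>, and \<open>0\<^sup>\<infinity>\<close> afterwards. So \<open>0\<^sup>j 1 0\<^sup>\<infinity>\<close> lies in the support
  of the limit iff \<open>c\<close> fails to halt on \<open>(x, y)\<close> for some \<open>y\<close>, a \<open>\<Sigma>\<^sub>2\<close>-complete condition.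

  By ergodicity almost every point contains infinitely many letters 3, and the orbit of every such
  point merges with the orbit of \<open>3 0\<^sup>\<infinity>\<close>.
\<close>

section \<open>A calculus of total computable functions\<close>

abbreviation pfst :: "nat \<Rightarrow> nat" where "pfst n \<equiv> fst (prod_decode n)"
abbreviation psnd :: "nat \<Rightarrow> nat" where "psnd n \<equiv> snd (prod_decode n)"

definition computable_pred :: "(nat \<Rightarrow> bool) \<Rightarrow> bool" where
  "computable_pred P \<longleftrightarrow> computable (\<lambda>n. if P n then 1 else 0)"

text \<open>The rules are stated for composed arguments, so \<open>intro cintro\<close> follows the
  syntax of a term. A function that also occurs under a packed argument, as in
  \<open>f (pfst w)\<close>, is supplied through \<open>computable_comp\<close>.\<close>

named_theorems cintro

lemma computable_id [cintro]: "computable (\<lambda>n. n)"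
proof -
  \<comment> \<open>The identity is not a basic function; pairing the two projections rebuilds the
    input.\<close>
  have "partial_recursive (pair_pfun (\<lambda>n. Some (pfst n)) (\<lambda>n. Some (psnd n)))"
    by (intro partial_recursive.intros)
  then show ?thesis
    by (simp add: computable_def pair_pfun_def[abs_def])
qed

lemma computable_comp: "computable f \<Longrightarrow> computable g \<Longrightarrow> computable (\<lambda>n. f (g n))"
  unfolding computable_def
  by (drule (1) partial_recursive.comp) simp

lemma computable_Suc [cintro]: "computable f \<Longrightarrow> computable (\<lambda>n. Suc (f n))"
  by (rule computable_comp[of Suc]) (simp_all add: computable_def partial_recursive.succ)

lemma computable_pfst [cintro]: "computable f \<Longrightarrow> computable (\<lambda>n. pfst (f n))"
  by (rule computable_comp[of pfst]) (simp_all add: computable_def partial_recursive.left)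

lemma computable_psnd [cintro]: "computable f \<Longrightarrow> computable (\<lambda>n. psnd (f n))"
  by (rule computable_comp[of psnd]) (simp_all add: computable_def partial_recursive.right)

lemma computable_pair [cintro]:
  "computable f \<Longrightarrow> computable g \<Longrightarrow> computable (\<lambda>n. prod_encode (f n, g n))"
  unfolding computable_def
  by (drule (1) partial_recursive.pair) (simp add: pair_pfun_def[abs_def])

lemma computable_const [cintro]: "computable (\<lambda>n. c)"
proof (induction c)
  case 0
  show ?case by (simp add: computable_def partial_recursive.zero)
qed (rule computable_Suc)

text \<open>\<open>prim_rec_pfun\<close> keeps its parameter available to the step function. Taking
  the whole input \<open>n\<close> as parameter lets \<open>B\<close> depend on it; the bound
  \<open>m n\<close> is substituted at the end.\<close>

lemma computable_rec [cintro]: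
  assumes "computable a" "computable m"
    and "computable (\<lambda>w. B (pfst w) (pfst (psnd w)) (psnd (psnd w)))"
  shows "computable (\<lambda>n. rec_nat (a n) (B n) (m n))"
proof -
  let ?f = "\<lambda>n. Some (a n)" and ?g = "\<lambda>w. Some (B (pfst w) (pfst (psnd w)) (psnd (psnd w)))"
  have "rec_nat (Some (a n)) (\<lambda>i v. Option.bind v (\<lambda>r. ?g (prod_encode (n, prod_encode (i, r))))) k
      = Some (rec_nat (a n) (B n) k)" for n k
    by (induction k) simp_all
  then have "prim_rec_pfun ?f ?g = (\<lambda>w. Some (rec_nat (a (pfst w)) (B (pfst w)) (psnd w)))"
    by (simp add: fun_eq_iff prim_rec_pfun_def split_beta)
  moreover have "partial_recursive (prim_rec_pfun ?f ?g)"
    using assms unfolding computable_def by (intro partial_recursive.prim_rec)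
  ultimately have "computable (\<lambda>w. rec_nat (a (pfst w)) (B (pfst w)) (psnd w))"
    by (simp add: computable_def)
  from computable_comp[OF this computable_pair[OF computable_id assms(2)]]
  show ?thesis by simp
qed

lemma computable_add [cintro]: "computable f \<Longrightarrow> computable g \<Longrightarrow> computable (\<lambda>n. f n + g n)"
proof -
  assume "computable f" "computable g"
  then have "computable (\<lambda>n. rec_nat (f n) (\<lambda>i r. Suc r) (g n))"
    by (intro cintro)
  moreover have "rec_nat a (\<lambda>i r. Suc r) b = a + b" for a b :: nat
    by (induction b) simp_all
  ultimately show ?thesis by simp
qed

lemma computable_mult [cintro]: "computable f \<Longrightarrow> computable g \<Longrightarrow> computable (\<lambda>n. f n * g n)"
proof -
  assume fg: "computable f" "computable g"
  have "computable (\<lambda>n. rec_nat 0 (\<lambda>i r. r + f n) (g n))"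
    by (intro cintro fg computable_comp[OF fg(1)])
  moreover have "rec_nat 0 (\<lambda>i r. r + a) b = a * b" for a b :: nat
    by (induction b) simp_all
  ultimately show ?thesis by simp
qed

lemma computable_power [cintro]: "computable f \<Longrightarrow> computable g \<Longrightarrow> computable (\<lambda>n. f n ^ g n)"
proof -
  assume fg: "computable f" "computable g"
  have "computable (\<lambda>n. rec_nat 1 (\<lambda>i r. r * f n) (g n))"
    by (intro cintro fg computable_comp[OF fg(1)])
  moreover have "rec_nat 1 (\<lambda>i r. r * a) b = a ^ b" for a b :: nat
    by (induction b) simp_all
  ultimately show ?thesis by simp
qed

lemma computable_diff [cintro]: "computable f \<Longrightarrow> computable g \<Longrightarrow> computable (\<lambda>n. f n - g n)"
proof -
  assume fg: "computable f" "computable g"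
  have pred: "computable (\<lambda>n. h n - 1)" if "computable h" for h
  proof -
    have "computable (\<lambda>n. rec_nat 0 (\<lambda>i r. i) (h n))"
      by (intro cintro that)
    moreover have "rec_nat 0 (\<lambda>i r. i) b = b - 1" for b :: nat
      by (induction b) simp_all
    ultimately show ?thesis by simp
  qed
  have "computable (\<lambda>n. rec_nat (f n) (\<lambda>i r. r - 1) (g n))"
    by (intro cintro fg pred)
  moreover have "rec_nat a (\<lambda>i r. r - 1) b = a - b" for a b :: nat
    by (induction b) simp_all
  ultimately show ?thesis by simp
qed

lemma computable_if [cintro]:
  assumes "computable_pred P" "computable f" "computable g"
  shows "computable (\<lambda>n. if P n then f n else g n)"
proof -
  have "computable (\<lambda>n. rec_nat (g n) (\<lambda>i r. f n) (if P n then 1 else 0))"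
    using assms(1) unfolding computable_pred_def
    by (intro cintro assms(2,3) computable_comp[OF assms(2)])
  moreover have "rec_nat (g n) (\<lambda>i r. f n) (if P n then 1 else 0) = (if P n then f n else g n)" for n
    by simp
  ultimately show ?thesis by simp
qed

lemma computable_pred_less [cintro]:
  assumes "computable f" "computable g"
  shows "computable_pred (\<lambda>n. f n < g n)"
proof -
  have "computable (\<lambda>n. 1 - (1 - (g n - f n)))"
    by (intro cintro assms)
  moreover have "(1 - (1 - (g n - f n))) = (if f n < g n then 1 else 0)" for n
    by auto
  ultimately show ?thesis by (simp add: computable_pred_def)
qed

lemma computable_pred_not [cintro]:
  assumes "computable_pred P"
  shows "computable_pred (\<lambda>n. \<not> P n)"
proof -
  have "computable (\<lambda>n. if P n then 0 else 1)"
    by (intro cintro assms)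
  moreover have "(if P n then 0 else 1) = (if \<not> P n then 1 else (0::nat))" for n
    by simp
  ultimately show ?thesis by (simp add: computable_pred_def)
qed

lemma computable_pred_conj [cintro]:
  assumes "computable_pred P" "computable_pred Q"
  shows "computable_pred (\<lambda>n. P n \<and> Q n)"
proof -
  have "computable (\<lambda>n. if P n then if Q n then 1 else 0 else 0)"
    by (intro cintro assms)
  moreover have "(if P n then if Q n then 1 else 0 else (0::nat)) = (if P n \<and> Q n then 1 else 0)" for n
    by simp
  ultimately show ?thesis by (simp add: computable_pred_def)
qed

lemma computable_pred_disj [cintro]:
  assumes "computable_pred P" "computable_pred Q"
  shows "computable_pred (\<lambda>n. P n \<or> Q n)"
proof -
  have "computable_pred (\<lambda>n. \<not> (\<not> P n \<and> \<not> Q n))"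
    by (intro cintro assms)
  then show ?thesis by simp
qed

lemma computable_pred_imp [cintro]:
  assumes "computable_pred P" "computable_pred Q"
  shows "computable_pred (\<lambda>n. P n \<longrightarrow> Q n)"
proof -
  have "computable_pred (\<lambda>n. \<not> P n \<or> Q n)"
    by (intro cintro assms)
  then show ?thesis by (simp only: imp_conv_disj)
qed

lemma computable_pred_le [cintro]:
  assumes "computable f" "computable g"
  shows "computable_pred (\<lambda>n. f n \<le> g n)"
proof -
  have "computable_pred (\<lambda>n. \<not> g n < f n)"
    by (intro cintro assms)
  then show ?thesis by (simp add: not_less)
qed

lemma computable_pred_eq [cintro]:
  fixes f g :: "nat \<Rightarrow> nat"
  assumes "computable f" "computable g"
  shows "computable_pred (\<lambda>n. f n = g n)"
proof -
  have "computable_pred (\<lambda>n. f n \<le> g n \<and> g n \<le> f n)"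
    by (intro cintro assms)
  then show ?thesis by (simp add: order_eq_iff)
qed

lemma computable_Least [cintro]:
  assumes P: "computable_pred (\<lambda>w. P (pfst w) (psnd w))" and ex: "\<And>n. \<exists>k. P n k"
  shows "computable (\<lambda>n. LEAST k. P n k)"
proof -
  let ?f = "\<lambda>w. Some (if P (pfst w) (psnd w) then 0 else 1 :: nat)"
  have first: "is_first_zero ?f n m \<longleftrightarrow> m = (LEAST k. P n k)" for n m
  proof -
    have "is_first_zero ?f n m \<longleftrightarrow> P n m \<and> (\<forall>j<m. \<not> P n j)"
      unfolding is_first_zero_def by auto
    also have "\<dots> \<longleftrightarrow> m = (LEAST k. P n k)"
      by (metis ex LeastI not_less_Least linorder_neqE_nat)
    finally show ?thesis .
  qed
  have "computable (\<lambda>w. if P (pfst w) (psnd w) then 0 else 1)"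
    by (intro cintro P)
  then have "partial_recursive (minimize_pfun ?f)"
    unfolding computable_def by (rule partial_recursive.minimize)
  moreover have "minimize_pfun ?f = (\<lambda>n. Some (LEAST k. P n k))"
    by (simp add: fun_eq_iff minimize_pfun_def ext[of "is_first_zero _ _", OF first])
  ultimately show ?thesis by (simp add: computable_def)
qed

text \<open>Bounded quantification becomes a search for a counterexample. The disjunct
  \<open>m n \<le> k\<close> stops it at the bound, so reaching \<open>m n\<close> means that there
  is none.\<close>

lemma computable_pred_all_less [cintro]:
  assumes "computable_pred (\<lambda>w. P (pfst w) (psnd w))" "computable m"
  shows "computable_pred (\<lambda>n. \<forall>k<m n. P n k)"
proof -
  have "computable_pred (\<lambda>n. (LEAST k. m n \<le> k \<or> \<not> P n k) = m n)"
    by (intro cintro assms computable_comp[OF assms(2)]) blast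
  moreover have "(LEAST k. m n \<le> k \<or> \<not> P n k) = m n \<longleftrightarrow> (\<forall>k<m n. P n k)" for n
  proof
    assume l: "(LEAST k. m n \<le> k \<or> \<not> P n k) = m n"
    show "\<forall>k<m n. P n k"
    proof (intro allI impI)
      fix k assume "k < m n"
      with l have "k < (LEAST k. m n \<le> k \<or> \<not> P n k)" by simp
      then show "P n k" by (metis (mono_tags, lifting) not_less_Least)
    qed
  next
    assume "\<forall>k<m n. P n k"
    then show "(LEAST k. m n \<le> k \<or> \<not> P n k) = m n"
      by (intro Least_equality) (auto simp: not_less[symmetric])
  qed
  ultimately show ?thesis by simp
qed

lemma computable_pred_ex_less [cintro]:
  assumes "computable_pred (\<lambda>w. P (pfst w) (psnd w))" "computable m"
  shows "computable_pred (\<lambda>n. \<exists>k<m n. P n k)"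
proof -
  have "computable_pred (\<lambda>n. \<not> (\<forall>k<m n. \<not> P n k))"
    by (intro cintro assms)
  then show ?thesis by simp
qed

lemma computable_div [cintro]:
  assumes "computable f" "computable g"
  shows "computable (\<lambda>n. f n div g n)"
proof -
  \<comment> \<open>The disjunct \<open>g n = 0\<close> ends the search at 0, the value of a
    division by zero.\<close>
  have "computable (\<lambda>n. LEAST k. f n < Suc k * g n \<or> g n = 0)"
  proof (intro cintro assms computable_comp[OF assms(1)] computable_comp[OF assms(2)])
    fix n
    show "\<exists>k. f n < Suc k * g n \<or> g n = 0"
      by (rule exI[of _ "f n"]) (cases "g n"; simp)
  qed
  moreover have "(LEAST k. f n < Suc k * g n \<or> g n = 0) = f n div g n" for n
  proof (cases "g n = 0")
    case False
    then show ?thesis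
      by (intro Least_equality)
        (simp_all add: dividend_less_div_times less_Suc_eq_le[symmetric] div_less_iff_less_mult)
  qed simp
  ultimately show ?thesis by simp
qed

lemma computable_mod [cintro]:
  assumes "computable f" "computable g"
  shows "computable (\<lambda>n. f n mod g n)"
  unfolding modulo_nat_def by (intro cintro assms)

section \<open>Computing with lists\<close>

text \<open>\<open>list_encode\<close> maps \<open>x # xs\<close> to the successor of a pair and
  \<open>[]\<close> to 0, hence the subtraction. Since \<open>prod_decode 0\<close> is
  \<open>(0, 0)\<close>, the tail of the empty list is empty again.\<close>

definition tail_code :: "nat \<Rightarrow> nat" where
  "tail_code L = psnd (L - 1)"

definition drop_code :: "nat \<Rightarrow> nat \<Rightarrow> nat" where
  "drop_code L k = rec_nat L (\<lambda>i r. tail_code r) k"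

definition nth_code :: "nat \<Rightarrow> nat \<Rightarrow> nat" where
  "nth_code L k = pfst (drop_code L k - 1)"

definition length_code :: "nat \<Rightarrow> nat" where
  "length_code L = (LEAST k. drop_code L k = 0)"

lemma drop_code_list_encode [simp]: "drop_code (list_encode xs) k = list_encode (drop k xs)"
proof (induction k)
  case (Suc k)
  have "tail_code (list_encode ys) = list_encode (tl ys)" for ys
    by (cases ys) (simp_all add: tail_code_def, simp add: prod_decode_def prod_decode_aux.simps)
  with Suc show ?case
    by (simp add: drop_code_def drop_Suc tl_drop)
qed (simp add: drop_code_def)

lemma nth_code_list_encode [simp]: "k < length xs \<Longrightarrow> nth_code (list_encode xs) k = xs ! k"
  by (simp add: nth_code_def Cons_nth_drop_Suc[symmetric])

lemma list_encode_eq_0_iff [simp]: "list_encode xs = 0 \<longleftrightarrow> xs = []"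
  by (cases xs) simp_all

lemma length_code_list_encode [simp]: "length_code (list_encode xs) = length xs"
  unfolding length_code_def by (intro Least_equality) simp_all

lemma computable_drop_code [cintro]:
  "computable f \<Longrightarrow> computable g \<Longrightarrow> computable (\<lambda>n. drop_code (f n) (g n))"
  unfolding drop_code_def tail_code_def by (intro cintro)

lemma computable_nth_code [cintro]:
  "computable f \<Longrightarrow> computable g \<Longrightarrow> computable (\<lambda>n. nth_code (f n) (g n))"
  unfolding nth_code_def by (intro cintro)

lemma computable_length_code [cintro]:
  assumes "computable f"
  shows "computable (\<lambda>n. length_code (f n))"
  unfolding length_code_def
proof (intro cintro computable_comp[OF assms])
  show "\<exists>k. drop_code (f n) k = 0" for n
    using drop_code_list_encode[of "list_decode (f n)" "length (list_decode (f n))"] by auto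
qed

lemma computable_list_encode_map [cintro]:
  assumes "computable m" "computable (\<lambda>w. G (pfst w) (psnd w))"
  shows "computable (\<lambda>n. list_encode (map (G n) [0..<m n]))"
proof -
  have G: "computable (\<lambda>n. G (a n) (b n))" if "computable a" "computable b" for a b
    using computable_comp[OF assms(2) computable_pair[OF that]] by simp
  \<comment> \<open>The code is built from the last entry on: step \<open>i\<close> prepends the
    entry at \<open>m n - Suc i\<close>.\<close>
  have "computable (\<lambda>n. rec_nat 0 (\<lambda>i r. Suc (prod_encode (G n (m n - Suc i), r))) (m n))"
    by (intro cintro assms(1) computable_comp[OF assms(1)] G)
  moreover have "rec_nat 0 (\<lambda>i r. Suc (prod_encode (G n (M - Suc i), r))) k
      = list_encode (map (G n) [M - k..<M])" if "k \<le> M" for n k M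
    using that
  proof (induction k)
    case (Suc k)
    then have "[M - Suc k..<M] = (M - Suc k) # [M - k..<M]"
      by (simp add: upt_conv_Cons Suc_diff_Suc)
    with Suc show ?case by simp
  qed simp
  ultimately show ?thesis by simp
qed

section \<open>A universal \<open>\<Sigma>\<^sub>2\<close> set\<close>

abbreviation triple :: "nat \<Rightarrow> nat \<Rightarrow> nat \<Rightarrow> nat" where
  "triple a b c \<equiv> prod_encode (a, prod_encode (b, c))"
abbreviation pmid :: "nat \<Rightarrow> nat" where "pmid n \<equiv> pfst (psnd n)"
abbreviation plast :: "nat \<Rightarrow> nat" where "plast n \<equiv> psnd (psnd n)"

lemma ex_triple: "(\<exists>J. P J) \<longleftrightarrow> (\<exists>a b c. P (triple a b c))"
  by (metis prod_decode_inverse prod.collapse)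

text \<open>
  A judgement \<open>triple c n v\<close> says that the program \<open>c\<close> yields \<open>v\<close> on input \<open>n\<close>. A program
  \<open>triple t f g\<close> is the constructor number \<open>t\<close> of \<^const>\<open>partial_recursive\<close> applied to \<open>f\<close> and \<open>g\<close>;
  minimization has number 8, and 7 is the auxiliary program that succeeds on \<open>(a, m)\<close> iff \<open>f\<close> takes
  positive values on all \<open>(a, j)\<close> with \<open>j < m\<close>.
\<close>

definition eval_axiom :: "nat \<Rightarrow> bool" where
  "eval_axiom J \<longleftrightarrow>
     pfst (pfst J) = 0 \<and> plast J = 0
   \<or> pfst (pfst J) = 1 \<and> plast J = Suc (pmid J)
   \<or> pfst (pfst J) = 2 \<and> plast J = pfst (pmid J)
   \<or> pfst (pfst J) = 3 \<and> plast J = psnd (pmid J)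
   \<or> pfst (pfst J) = 7 \<and> psnd (pmid J) = 0 \<and> plast J = 0"

definition eval_rule :: "nat \<Rightarrow> nat \<Rightarrow> nat \<Rightarrow> bool" where
  "eval_rule J1 J2 J \<longleftrightarrow>
     pfst (pfst J) = 4 \<and> pfst J1 = pmid (pfst J) \<and> pmid J1 = pmid J
       \<and> pfst J2 = plast (pfst J) \<and> pmid J2 = pmid J \<and> plast J = prod_encode (plast J1, plast J2)
   \<or> pfst (pfst J) = 5 \<and> pfst J1 = plast (pfst J) \<and> pmid J1 = pmid J
       \<and> pfst J2 = pmid (pfst J) \<and> pmid J2 = plast J1 \<and> plast J = plast J2
   \<or> pfst (pfst J) = 6 \<and> psnd (pmid J) = 0 \<and> pfst J1 = pmid (pfst J) \<and> pmid J1 = pfst (pmid J)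
       \<and> plast J = plast J1
   \<or> pfst (pfst J) = 6 \<and> 0 < psnd (pmid J) \<and> pfst J1 = pfst J
       \<and> pmid J1 = prod_encode (pfst (pmid J), psnd (pmid J) - 1)
       \<and> pfst J2 = plast (pfst J)
       \<and> pmid J2 = triple (pfst (pmid J)) (psnd (pmid J) - 1) (plast J1) \<and> plast J = plast J2
   \<or> pfst (pfst J) = 7 \<and> 0 < psnd (pmid J) \<and> pfst J1 = pfst J
       \<and> pmid J1 = prod_encode (pfst (pmid J), psnd (pmid J) - 1)
       \<and> pfst J2 = pmid (pfst J) \<and> pmid J2 = pmid J1 \<and> 0 < plast J2 \<and> plast J = 0
   \<or> pfst (pfst J) = 8 \<and> pfst J1 = prod_encode (7, psnd (pfst J)) \<and> pmid J1 = psnd J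
       \<and> pfst J2 = pmid (pfst J) \<and> pmid J2 = psnd J \<and> plast J2 = 0"

inductive derivable :: "nat \<Rightarrow> bool" where
  axiom: "eval_axiom J \<Longrightarrow> derivable J"
| rule: "derivable J1 \<Longrightarrow> derivable J2 \<Longrightarrow> eval_rule J1 J2 J \<Longrightarrow> derivable J"

text \<open>With the premises written as triples, simplification evaluates all projections in
  \<open>eval_rule\<close>; this produces the inversion lemmas below for the program
  numbers.\<close>

lemma derivable_iff:
  "derivable J \<longleftrightarrow> eval_axiom J \<or> (\<exists>a b c a' b' c'. derivable (triple a b c)
      \<and> derivable (triple a' b' c') \<and> eval_rule (triple a b c) (triple a' b' c') J)"
proof -
  have "derivable J \<longleftrightarrow> eval_axiom J \<or> (\<exists>J1 J2. derivable J1 \<and> derivable J2 \<and> eval_rule J1 J2 J)"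
    by (subst derivable.simps) blast
  also have "(\<exists>J1 J2. derivable J1 \<and> derivable J2 \<and> eval_rule J1 J2 J) \<longleftrightarrow>
      (\<exists>a b c J2. derivable (triple a b c) \<and> derivable J2 \<and> eval_rule (triple a b c) J2 J)"
    by (rule ex_triple)
  finally show ?thesis
    by (simp only: ex_triple[of "\<lambda>J2. derivable J1 \<and> derivable J2 \<and> eval_rule J1 J2 J" for J1])
qed

lemma derivable_basic:
  "derivable (triple (triple 0 f g) n v) \<longleftrightarrow> v = 0"
  "derivable (triple (triple 1 f g) n v) \<longleftrightarrow> v = Suc n"
  "derivable (triple (triple 2 f g) n v) \<longleftrightarrow> v = pfst n"
  "derivable (triple (triple 3 f g) n v) \<longleftrightarrow> v = psnd n"
  by (subst derivable_iff, simp add: eval_axiom_def eval_rule_def)+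

lemma derivable_pair:
  "derivable (triple (triple 4 f g) n v) \<longleftrightarrow>
     (\<exists>a b. derivable (triple f n a) \<and> derivable (triple g n b) \<and> v = prod_encode (a, b))"
  by (subst derivable_iff) (auto simp: eval_axiom_def eval_rule_def)

lemma derivable_comp:
  "derivable (triple (triple 5 f g) n v) \<longleftrightarrow>
     (\<exists>a. derivable (triple g n a) \<and> derivable (triple f a v))"
  by (subst derivable_iff) (auto simp: eval_axiom_def eval_rule_def)

lemma derivable_prim_rec_0:
  "derivable (triple (triple 6 f g) (prod_encode (a, 0)) v) \<longleftrightarrow> derivable (triple f a v)"
  by (subst derivable_iff) (auto simp: eval_axiom_def eval_rule_def)

lemma derivable_prim_rec_Suc:
  "derivable (triple (triple 6 f g) (prod_encode (a, Suc m)) v) \<longleftrightarrow>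
     (\<exists>r. derivable (triple (triple 6 f g) (prod_encode (a, m)) r)
        \<and> derivable (triple g (triple a m r) v))"
  by (subst derivable_iff) (auto simp: eval_axiom_def eval_rule_def)

lemma derivable_positive_0:
  "derivable (triple (triple 7 f g) (prod_encode (a, 0)) v) \<longleftrightarrow> v = 0"
  by (subst derivable_iff) (auto simp: eval_axiom_def eval_rule_def)

lemma derivable_positive_Suc:
  "derivable (triple (triple 7 f g) (prod_encode (a, Suc m)) v) \<longleftrightarrow>
     v = 0 \<and> (\<exists>u. derivable (triple (triple 7 f g) (prod_encode (a, m)) u))
       \<and> (\<exists>w>0. derivable (triple f (prod_encode (a, m)) w))"
  by (subst derivable_iff) (auto simp: eval_axiom_def eval_rule_def)

lemma derivable_minimize:
  "derivable (triple (triple 8 f g) a m) \<longleftrightarrow>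
     (\<exists>u. derivable (triple (triple 7 f g) (prod_encode (a, m)) u))
       \<and> derivable (triple f (prod_encode (a, m)) 0)"
  by (subst derivable_iff) (auto simp: eval_axiom_def eval_rule_def)

lemma minimize_pfun_eq_Some_iff: "minimize_pfun f a = Some m \<longleftrightarrow> is_first_zero f a m"
proof -
  have uniq: "m = m'" if "is_first_zero f a m" "is_first_zero f a m'" for m m'
    using that unfolding is_first_zero_def
    by (metis linorder_neqE_nat option.inject less_irrefl)
  have "(THE m. is_first_zero f a m) = m" if "is_first_zero f a m" for m
    using that uniq by blast
  then show ?thesis
    unfolding minimize_pfun_def by auto
qed

text \<open>An equivalence is required, because a program that fails to halt must have no
  derivation. The inversion lemmas provide both directions.\<close>

lemma ex_program:
  "partial_recursive f \<Longrightarrow> \<exists>c. \<forall>n v. derivable (triple c n v) \<longleftrightarrow> f n = Some v"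
proof (induction rule: partial_recursive.induct)
  case zero
  show ?case by (intro exI[of _ "triple 0 0 0"]) (auto simp: derivable_basic)
next
  case succ
  show ?case by (intro exI[of _ "triple 1 0 0"]) (auto simp only: derivable_basic)
next
  case left
  show ?case by (intro exI[of _ "triple 2 0 0"]) (auto simp: derivable_basic)
next
  case right
  show ?case by (intro exI[of _ "triple 3 0 0"]) (auto simp: derivable_basic)
next
  case (pair f g)
  then obtain c d where "\<forall>n v. derivable (triple c n v) \<longleftrightarrow> f n = Some v"
    "\<forall>n v. derivable (triple d n v) \<longleftrightarrow> g n = Some v" by blast
  then show ?case
    by (intro exI[of _ "triple 4 c d"])
      (auto simp: derivable_pair pair_pfun_def bind_eq_Some_conv)
next
  case (comp f g)
  then obtain c d where "\<forall>n v. derivable (triple c n v) \<longleftrightarrow> f n = Some v"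
    "\<forall>n v. derivable (triple d n v) \<longleftrightarrow> g n = Some v" by blast
  then show ?case
    by (intro exI[of _ "triple 5 c d"]) (auto simp: derivable_comp bind_eq_Some_conv)
next
  case (prim_rec f g)
  then obtain c d where cd: "\<forall>n v. derivable (triple c n v) \<longleftrightarrow> f n = Some v"
    "\<forall>n v. derivable (triple d n v) \<longleftrightarrow> g n = Some v" by blast
  have "derivable (triple (triple 6 c d) (prod_encode (a, m)) v) \<longleftrightarrow>
      prim_rec_pfun f g (prod_encode (a, m)) = Some v" for a m v
    by (induction m arbitrary: v)
      (auto simp: derivable_prim_rec_0 derivable_prim_rec_Suc cd prim_rec_pfun_def bind_eq_Some_conv)
  then show ?case
    by (metis prod_decode_inverse prod.collapse)
next
  case (minimize f)
  then obtain c where c: "\<forall>n v. derivable (triple c n v) \<longleftrightarrow> f n = Some v" by blast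
  \<comment> \<open>Program 7 certifies that the search has met only positive values before
    \<open>m\<close>.\<close>
  have "(\<exists>u. derivable (triple (triple 7 c 0) (prod_encode (a, m)) u)) \<longleftrightarrow>
      (\<forall>j<m. \<exists>w>0. f (prod_encode (a, j)) = Some w)" for a m
    by (induction m) (auto simp: derivable_positive_0 derivable_positive_Suc c less_Suc_eq)
  then have "derivable (triple (triple 8 c 0) a m) \<longleftrightarrow> minimize_pfun f a = Some m" for a m
    by (auto simp: derivable_minimize c minimize_pfun_eq_Some_iff is_first_zero_def)
  then show ?case by blast
qed

text \<open>A finite witness for \<open>derivable\<close>. All quantifiers in it are bounded, so it
  can be checked by computation.\<close>

definition valid_derivation :: "nat \<Rightarrow> bool" where
  "valid_derivation L \<longleftrightarrow> (\<forall>k<length_code L. eval_axiom (nth_code L k) \<or>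
     (\<exists>i<k. \<exists>j<k. eval_rule (nth_code L i) (nth_code L j) (nth_code L k)))"

lemma valid_derivation_list_encode:
  "valid_derivation (list_encode xs) \<longleftrightarrow> (\<forall>k<length xs. eval_axiom (xs ! k) \<or>
     (\<exists>i<k. \<exists>j<k. eval_rule (xs ! i) (xs ! j) (xs ! k)))"
  by (auto simp: valid_derivation_def)

lemma valid_derivation_sound:
  assumes "valid_derivation L" "k < length_code L"
  shows "derivable (nth_code L k)"
  using assms(2)
proof (induction k rule: less_induct)
  case (less k)
  with assms(1) consider "eval_axiom (nth_code L k)"
    | i j where "i < k" "j < k" "eval_rule (nth_code L i) (nth_code L j) (nth_code L k)"
    unfolding valid_derivation_def by blast
  then show ?case
  proof cases
    case 2
    with less show ?thesis by (meson derivable.rule less_trans)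
  qed (rule derivable.axiom)
qed

text \<open>The derivations of the two premises are concatenated and \<open>J\<close> is appended;
  in the second one all references move by \<open>length xs\<close>.\<close>

lemma valid_derivation_complete:
  assumes "derivable J"
  shows "\<exists>xs. valid_derivation (list_encode xs) \<and> J \<in> set xs"
  using assms
proof induction
  case (axiom J)
  then show ?case
    by (intro exI[of _ "[J]"]) (simp add: valid_derivation_list_encode del: list_encode.simps)
next
  case (rule J1 J2 J)
  from rule obtain xs ys where xs: "valid_derivation (list_encode xs)" "J1 \<in> set xs"
    and ys: "valid_derivation (list_encode ys)" "J2 \<in> set ys" by blast
  let ?zs = "xs @ ys @ [J]"
  have "eval_axiom (?zs ! k) \<or> (\<exists>i<k. \<exists>j<k. eval_rule (?zs ! i) (?zs ! j) (?zs ! k))"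
    if "k < length ?zs" for k
  proof -
    have "k < length xs \<or> (\<exists>k'<length ys. k = length xs + k') \<or> k = length xs + length ys"
      using that by (auto intro!: exI[of _ "k - length xs"])
    then consider "k < length xs" | k' where "k = length xs + k'" "k' < length ys"
      | "k = length xs + length ys"
      by blast
    then show ?thesis
    proof cases
      case 1
      then have eq: "?zs ! i = xs ! i" if "i \<le> k" for i
        using that by (simp add: nth_append)
      from 1 xs(1) consider "eval_axiom (xs ! k)"
        | i j where "i < k" "j < k" "eval_rule (xs ! i) (xs ! j) (xs ! k)"
        unfolding valid_derivation_list_encode by blast
      then show ?thesis
      proof cases
        case (2 i j)
        then show ?thesis
          by (intro disjI2 exI[of _ i] exI[of _ j] conjI) (simp_all add: eq)
      qed (simp add: eq)
    next
      case (2 k')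
      with ys(1) consider "eval_axiom (ys ! k')"
        | i j where "i < k'" "j < k'" "eval_rule (ys ! i) (ys ! j) (ys ! k')"
        unfolding valid_derivation_list_encode by blast
      then show ?thesis
      proof cases
        case (2 i j)
        with \<open>k = length xs + k'\<close> \<open>k' < length ys\<close> show ?thesis
          by (intro disjI2 exI[of _ "length xs + i"] exI[of _ "length xs + j"] conjI)
            (simp_all add: nth_append)
      qed (use 2 in \<open>simp add: nth_append\<close>)
    next
      case 3
      from xs(2) ys(2) obtain i j where "i < length xs" "xs ! i = J1" "j < length ys" "ys ! j = J2"
        by (auto simp: in_set_conv_nth)
      with 3 rule(3) show ?thesis
        by (intro disjI2 exI[of _ i] exI[of _ "length xs + j"] conjI) (simp_all add: nth_append)
    qed
  qed
  then have "valid_derivation (list_encode ?zs)"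
    unfolding valid_derivation_list_encode by blast
  then show ?case by (intro exI[of _ ?zs]) simp
qed

text \<open>
  The code \<open>e\<close> of \<open>((c, x), y)\<close> is alive until stage \<open>z\<close> if \<open>z\<close> does not witness that
  the program \<open>c\<close> halts on \<open>(x, y)\<close>.
\<close>

definition alive :: "nat \<Rightarrow> nat \<Rightarrow> bool" where
  "alive e z \<longleftrightarrow> \<not> (valid_derivation z \<and> (\<exists>k<length_code z.
     pfst (nth_code z k) = pfst (pfst e) \<and>
     pmid (nth_code z k) = prod_encode (psnd (pfst e), psnd e)))"

text \<open>Soundness and completeness of derivations: a stage refuting \<open>alive\<close> is a
  derivation that contains a judgement on \<open>c\<close> and \<open>(x, y)\<close>, with any
  value.\<close>

lemma all_alive_iff:
  "(\<forall>z. alive (prod_encode (prod_encode (c, x), y)) z) \<longleftrightarrow>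
     \<not> (\<exists>v. derivable (triple c (prod_encode (x, y)) v))"
proof -
  have "(\<exists>z. valid_derivation z \<and> (\<exists>k<length_code z. nth_code z k = J)) \<longleftrightarrow> derivable J" for J
    by (metis valid_derivation_sound valid_derivation_complete in_set_conv_nth
        length_code_list_encode nth_code_list_encode)
  moreover have "pfst j = c \<and> pmid j = n \<longleftrightarrow> (\<exists>v. j = triple c n v)" for j n
    by (metis prod_encode_inverse prod_decode_inverse prod.collapse fst_conv snd_conv)
  ultimately show ?thesis
    unfolding alive_def by simp blast
qed

text \<open>The number 0 decodes to \<open>((0, 0), 0)\<close>, and program 0 is a code of the zero
  function, which halts. Guess 0 therefore dies, which puts the zero sequence into the
  attractor.\<close>

lemma not_alive_0: "\<exists>z. \<not> alive 0 z"
proof -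
  have 0: "prod_encode (0, 0) = 0"
    by (simp add: prod_encode_def)
  have "derivable (triple 0 (prod_encode (0, 0)) 0)"
    using derivable_basic(1)[of 0 0 0 0] by (simp add: 0)
  then have "\<not> (\<forall>z. alive (prod_encode (prod_encode (0, 0), 0)) z)"
    using all_alive_iff by blast
  then show ?thesis by (simp add: 0)
qed

lemma computable_pred_eval_axiom [cintro]:
  "computable f \<Longrightarrow> computable_pred (\<lambda>n. eval_axiom (f n))"
  unfolding eval_axiom_def by (intro cintro)

lemma computable_pred_eval_rule [cintro]:
  "computable f \<Longrightarrow> computable g \<Longrightarrow> computable h \<Longrightarrow>
    computable_pred (\<lambda>n. eval_rule (f n) (g n) (h n))"
  unfolding eval_rule_def by (intro cintro)

lemma computable_pred_alive [cintro]:
  assumes "computable f" "computable g"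
  shows "computable_pred (\<lambda>n. alive (f n) (g n))"
  unfolding alive_def valid_derivation_def
  by (intro cintro assms computable_comp[OF assms(1)] computable_comp[OF assms(2)])

theorem Sigma_2_universal:
  assumes "Sigma_set 2 S"
  shows "\<exists>g. computable g \<and> (\<forall>x. x \<in> S \<longleftrightarrow> (\<exists>y. \<forall>z. alive (prod_encode (g x, y)) z))"
proof -
  from assms obtain D where D: "decidable D"
    and S: "S = {x. \<exists>y. \<forall>z. prod_encode (prod_encode (x, y), z) \<in> D}"
    by (auto simp: numeral_2_eq_2)
  \<comment> \<open>On \<open>D\<close> the value is positive, so the search started at
    \<open>n\<close> halts exactly if some \<open>(n, z)\<close> lies outside \<open>D\<close>. The
    inner universal quantifier of \<open>S\<close> thus says that the program \<open>c\<close> does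
    not halt.\<close>
  let ?f = "\<lambda>n. Some (if n \<in> D then 1 else 0 :: nat)"
  have "partial_recursive (minimize_pfun ?f)"
    using D unfolding decidable_def computable_def by (rule partial_recursive.minimize)
  then obtain c where c: "\<And>n v. derivable (triple c n v) \<longleftrightarrow> is_first_zero ?f n v"
    using ex_program by (metis minimize_pfun_eq_Some_iff)
  have first_zero: "(\<exists>v. is_first_zero ?f n v) \<longleftrightarrow> (\<exists>z. prod_encode (n, z) \<notin> D)" for n
  proof
    assume "\<exists>z. prod_encode (n, z) \<notin> D"
    then obtain m where m: "prod_encode (n, m) \<notin> D" "\<And>j. j < m \<Longrightarrow> prod_encode (n, j) \<in> D"
      using exists_least_iff[of "\<lambda>z. prod_encode (n, z) \<notin> D"] by auto
    have "\<exists>v>0. ?f (prod_encode (n, j)) = Some v" if "j < m" for j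
      using m(2)[OF that] by simp
    with m(1) have "is_first_zero ?f n m"
      unfolding is_first_zero_def by simp
    then show "\<exists>v. is_first_zero ?f n v" ..
  next
    assume "\<exists>v. is_first_zero ?f n v"
    then obtain v where "?f (prod_encode (n, v)) = Some 0"
      unfolding is_first_zero_def by blast
    then show "\<exists>z. prod_encode (n, z) \<notin> D"
      by (metis option.inject zero_neq_one)
  qed
  have "computable (\<lambda>x. prod_encode (c, x))"
    by (intro cintro)
  moreover have "x \<in> S \<longleftrightarrow> (\<exists>y. \<forall>z. alive (prod_encode (prod_encode (c, x), y)) z)" for x
    by (simp add: S all_alive_iff c first_zero)
  ultimately show ?thesis by blast
qed

section \<open>The map and its main orbit\<close>

text \<open>Codes are moved by one to make room for the zero sequence: \<open>c = 0\<close> is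
  \<open>0^\<infinity>\<close>, and \<open>c = j + 1\<close> has its 1 at position
  \<open>j\<close>.\<close>

definition spike :: "nat \<Rightarrow> nat \<Rightarrow> nat" where
  "spike c = (\<lambda>i. if Suc i = c then 1 else 0)"

definition limit_code :: "nat \<Rightarrow> nat" where
  "limit_code e = (if \<forall>z. alive e z then Suc (pfst e) else 0)"

text \<open>Phase \<open>p = (e, n)\<close> works on guess \<open>e\<close> and tests the stages
  below \<open>p\<close> only, which makes its code computable. A refutation is never lost, so the
  code is \<open>limit_code e\<close> in all but finitely many phases of \<open>e\<close>.\<close>

definition phase_code :: "nat \<Rightarrow> nat" where
  "phase_code p = (if \<forall>z<p. alive (pfst p) z then Suc (pfst (pfst p)) else 0)"

text \<open>On the diagonal \<open>s\<close> the phase of guess \<open>e\<close> has about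
  \<open>(s + 1)^4 / 2^e\<close> deletions. The fourth power outweighs \<open>s + 1\<close> waiting
  times of order \<open>(s + 1)^2\<close>, yet polynomial growth keeps one diagonal short compared
  with all earlier ones together.\<close>

definition phase_length :: "nat \<Rightarrow> nat" where
  "phase_length p = Suc (pfst p + psnd p) ^ 4 div 2 ^ pfst p"

definition counter :: "nat \<Rightarrow> nat \<Rightarrow> nat" where
  "counter p = (\<lambda>i. if i = 0 then 3 else if i \<le> p then 2 else 0)"

definition word_state :: "nat \<Rightarrow> nat \<Rightarrow> nat \<Rightarrow> nat \<Rightarrow> nat" where
  "word_state c l p = (\<lambda>i. if i < l then spike c i else counter p (i - l))"

definition new_phase :: "nat \<Rightarrow> nat \<Rightarrow> nat" where
  "new_phase p = (\<lambda>i. if i < p then 2 else word_state (phase_code p) (phase_length p) (Suc p) (i - p))"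

text \<open>Output letter \<open>i\<close> must depend on the letters up to \<open>i + 1\<close>
  only. The search for the end of the run of 2s is therefore cut off at \<open>i + 1\<close>, and
  \<open>new_phase (i + 1) i = 2\<close> is then the letter required. The last case deletes the
  letter in front of the first 3, which affects position \<open>i\<close> iff that 3 is at
  \<open>i + 1\<close> or before.\<close>

definition attractor_map :: "(nat \<Rightarrow> nat) \<Rightarrow> nat \<Rightarrow> nat" where
  "attractor_map x = (\<lambda>i.
     if x 0 = 2 then x (Suc i)
     else if x 0 = 3 then new_phase (LEAST k. x (Suc k) \<noteq> 2 \<or> i < k) i
     else if \<exists>k<i + 2. x k = 3 then x (Suc i) else x i)"

lemma attractor_map_2: "x 0 = 2 \<Longrightarrow> attractor_map x = (\<lambda>i. x (Suc i))"
  by (simp add: attractor_map_def)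

lemma attractor_map_3:
  assumes "x 0 = 3" "x (Suc p) \<noteq> 2" "\<And>k. k < p \<Longrightarrow> x (Suc k) = 2"
  shows "attractor_map x = new_phase p"
proof
  fix i
  show "attractor_map x i = new_phase p i"
  proof (cases "i < p")
    case True
    have "(LEAST k. x (Suc k) \<noteq> 2 \<or> i < k) = Suc i"
      using True assms(3) by (intro Least_equality) (auto simp: not_less_eq_eq[symmetric])
    with True assms(1) show ?thesis
      by (simp add: attractor_map_def new_phase_def)
  next
    case False
    have "(LEAST k. x (Suc k) \<noteq> 2 \<or> i < k) = p"
      using False assms(2,3) by (intro Least_equality) (auto simp: not_less[symmetric])
    with assms(1) show ?thesis
      by (simp add: attractor_map_def)
  qed
qed

lemma attractor_map_delete:
  assumes "x 0 \<noteq> 2" "x (Suc l) = 3" "\<And>k. k \<le> l \<Longrightarrow> x k \<noteq> 3"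
  shows "attractor_map x = (\<lambda>i. if i < l then x i else x (Suc i))"
proof
  fix i
  have "(\<exists>k<i + 2. x k = 3) \<longleftrightarrow> l \<le> i"
    using assms(2,3) by (metis add_2_eq_Suc' less_Suc_eq_le not_less_eq_eq le_trans)
  moreover have "x 0 \<noteq> 3" using assms(3) by blast
  ultimately show "attractor_map x i = (if i < l then x i else x (Suc i))"
    using assms(1) by (auto simp: attractor_map_def)
qed

lemma attractor_map_fixed:
  assumes "\<And>i. x i < 2"
  shows "attractor_map x = x"
proof -
  have "x i \<noteq> 2" "x i \<noteq> 3" for i
    using assms[of i] by simp_all
  then show ?thesis by (simp add: attractor_map_def fun_eq_iff)
qed

lemma spike_less: "spike c i < 2"
  by (simp add: spike_def)

lemma attractor_map_spike: "attractor_map (spike c) = spike c"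
  by (rule attractor_map_fixed[OF spike_less])

lemma attractor_map_counter: "attractor_map (counter p) = new_phase p"
  by (rule attractor_map_3) (simp_all add: counter_def)

lemma attractor_map_word_state: "attractor_map (word_state c (Suc l) p) = word_state c l p"
proof -
  have "word_state c (Suc l) p k \<noteq> 3" if "k \<le> l" for k
    using that spike_less[of c k] by (simp add: word_state_def)
  moreover have "word_state c (Suc l) p 0 \<noteq> 2"
    using spike_less[of c 0] by (simp add: word_state_def)
  ultimately have "attractor_map (word_state c (Suc l) p)
      = (\<lambda>i. if i < l then word_state c (Suc l) p i else word_state c (Suc l) p (Suc i))"
    by (intro attractor_map_delete) (simp_all add: word_state_def counter_def)
  then show ?thesis
    by (auto simp: word_state_def fun_eq_iff)
qed

lemma word_state_0: "word_state c 0 p = counter p"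
  by (simp add: word_state_def)

lemma funpow_attractor_map_shift:
  assumes "\<And>i. i < l \<Longrightarrow> x i = 2"
  shows "(attractor_map ^^ l) x = (\<lambda>i. x (l + i))"
  using assms by (induction l) (simp_all add: attractor_map_2)

text \<open>Each step deletes the letter next to the 3, so the prefix is consumed from its right
  end; after \<open>l\<close> steps the net effect is a shift.\<close>

lemma funpow_attractor_map_delete:
  assumes "x 0 \<noteq> 2" "x l = 3" "\<And>k. k < l \<Longrightarrow> x k \<noteq> 3"
  shows "(attractor_map ^^ l) x = (\<lambda>i. x (l + i))"
  using assms
proof (induction l arbitrary: x)
  case (Suc l)
  have T: "attractor_map x = (\<lambda>i. if i < l then x i else x (Suc i))"
    using Suc.prems by (intro attractor_map_delete) auto
  have "(attractor_map ^^ l) (attractor_map x) = (\<lambda>i. attractor_map x (l + i))"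
  proof (rule Suc.IH)
    show "attractor_map x 0 \<noteq> 2"
      using Suc.prems by (cases l) (auto simp: T)
    show "attractor_map x k \<noteq> 3" if "k < l" for k
      using that Suc.prems(3) by (simp add: T)
  qed (use Suc.prems in \<open>simp add: T\<close>)
  then show ?case
    by (simp add: funpow_Suc_right T del: funpow.simps)
qed simp

lemma funpow_attractor_map_word_state:
  "q \<le> l \<Longrightarrow> (attractor_map ^^ q) (word_state c l p) = word_state c (l - q) p"
proof (induction q)
  case (Suc q)
  then have "l - q = Suc (l - Suc q)" by simp
  with Suc show ?case by (simp add: attractor_map_word_state)
qed simp

lemma funpow_attractor_map_new_phase:
  assumes "q \<le> phase_length p"
  shows "(attractor_map ^^ (p + q)) (new_phase p) =
    word_state (phase_code p) (phase_length p - q) (Suc p)"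
proof -
  have "(attractor_map ^^ p) (new_phase p) = word_state (phase_code p) (phase_length p) (Suc p)"
    by (subst funpow_attractor_map_shift) (simp_all add: new_phase_def)
  then have "(attractor_map ^^ (q + p)) (new_phase p) =
      (attractor_map ^^ q) (word_state (phase_code p) (phase_length p) (Suc p))"
    by (simp only: funpow_add comp_apply)
  with funpow_attractor_map_word_state[OF assms] show ?thesis
    by (simp add: add.commute)
qed

abbreviation main_orbit :: "nat \<Rightarrow> nat \<Rightarrow> nat" where
  "main_orbit i \<equiv> (attractor_map ^^ i) (counter 0)"

text \<open>Phase \<open>p\<close> takes one step from \<open>counter p\<close> to
  \<open>new_phase p\<close>, then \<open>p\<close> steps to drop the letters 2, then
  \<open>phase_length p\<close> deletions.\<close>

definition phase_start :: "nat \<Rightarrow> nat" where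
  "phase_start p = (\<Sum>q<p. Suc q + phase_length q)"

lemma phase_start_Suc: "phase_start (Suc p) = phase_start p + (Suc p + phase_length p)"
  by (simp add: phase_start_def)

lemma main_orbit_phase_start: "main_orbit (phase_start p) = counter p"
proof (induction p)
  case (Suc p)
  have "main_orbit (phase_start (Suc p)) =
      (attractor_map ^^ (p + phase_length p)) (attractor_map (main_orbit (phase_start p)))"
    by (simp add: phase_start_Suc funpow_add funpow_swap1 add.commute[of "phase_start p"])
  then show ?case
    by (simp add: Suc attractor_map_counter funpow_attractor_map_new_phase word_state_0)
qed (simp add: phase_start_def)

lemma main_orbit_word_state:
  assumes "q \<le> phase_length p"
  shows "main_orbit (phase_start p + (Suc p + q)) =
    word_state (phase_code p) (phase_length p - q) (Suc p)"
proof -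
  have "main_orbit (phase_start p + (Suc p + q)) =
      (attractor_map ^^ (p + q)) (attractor_map (main_orbit (phase_start p)))"
    by (simp add: funpow_add funpow_swap1 add.commute[of "phase_start p"])
  then show ?thesis
    by (simp add: main_orbit_phase_start attractor_map_counter funpow_attractor_map_new_phase[OF assms])
qed

text \<open>Leading letters 2 are shifted out, then deletions bring the next 3 to the front. The
  image now depends only on the number \<open>p\<close> of letters 2 behind this 3, a run that ends
  because a further 3 follows. Everything beyond is forgotten, and the orbit arrives at
  \<open>new_phase p\<close>.\<close>

lemma orbit_merges:
  assumes inf: "\<And>n. \<exists>i\<ge>n. x i = 3"
  shows "\<exists>n m. (attractor_map ^^ n) x = main_orbit m"
proof -
  define l where "l = (LEAST i. x i \<noteq> 2)"
  have "\<exists>i. x i \<noteq> 2" using inf[of 0] by (metis numeral_eq_iff semiring_norm(89))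
  then have l: "x l \<noteq> 2" "\<And>i. i < l \<Longrightarrow> x i = 2"
    unfolding l_def by (rule LeastI_ex) (auto dest: not_less_Least)
  define r where "r = (LEAST r. x (l + r) = 3)"
  have "\<exists>r. x (l + r) = 3" using inf[of l] by (auto simp: le_iff_add)
  then have r: "x (l + r) = 3" "\<And>k. k < r \<Longrightarrow> x (l + k) \<noteq> 3"
    unfolding r_def by (rule LeastI_ex) (auto dest: not_less_Least)
  have "(attractor_map ^^ (r + l)) x = (attractor_map ^^ r) (\<lambda>i. x (l + i))"
    by (simp add: funpow_add funpow_attractor_map_shift l)
  also have "\<dots> = (\<lambda>i. x (l + (r + i)))"
    using l r by (subst funpow_attractor_map_delete) simp_all
  finally have lr: "(attractor_map ^^ (r + l)) x = (\<lambda>i. x (l + (r + i)))" .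
  define p where "p = (LEAST p. x (l + (r + Suc p)) \<noteq> 2)"
  obtain c where "x (l + (r + Suc c)) = 3"
    using inf[of "Suc (l + r)"] by (auto simp: le_iff_add add.assoc)
  then have "x (l + (r + Suc c)) \<noteq> 2" by simp
  then have "\<exists>p. x (l + (r + Suc p)) \<noteq> 2" by blast
  then have p: "x (l + (r + Suc p)) \<noteq> 2" "\<And>k. k < p \<Longrightarrow> x (l + (r + Suc k)) = 2"
    unfolding p_def by (rule LeastI_ex) (auto dest: not_less_Least)
  have "(attractor_map ^^ Suc (r + l)) x = new_phase p"
    unfolding funpow.simps comp_apply lr using r p by (intro attractor_map_3) simp_all
  also have "\<dots> = main_orbit (Suc (phase_start p))"
    by (simp add: main_orbit_phase_start attractor_map_counter)
  finally show ?thesis by blast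
qed

section \<open>Time averages along the main orbit\<close>

text \<open>The deviation \<open>R n\<close> of the sum from \<open>n * G\<close> grows by at most
  \<open>\<epsilon>\<close> times the length over each late block, and by at most \<open>B'\<close>
  per step inside the block containing \<open>n\<close>. That block is at most an
  \<open>\<epsilon>\<close>-fraction of the time before it.\<close>

lemma cesaro_of_blocks:
  fixes a :: "nat \<Rightarrow> real" and \<tau> :: "nat \<Rightarrow> nat"
  defines "S n \<equiv> \<Sum>i<n. a i"
  assumes mono: "strict_mono \<tau>"
    and bound: "\<And>i. \<bar>a i\<bar> \<le> B"
    and blocks: "(\<lambda>s. (S (\<tau> (Suc s)) - S (\<tau> s)) / (real (\<tau> (Suc s)) - real (\<tau> s))) \<longlonglongrightarrow> G"
    and short: "(\<lambda>s. (real (\<tau> (Suc s)) - real (\<tau> s)) / real (\<tau> s)) \<longlonglongrightarrow> 0"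
  shows "(\<lambda>n. S n / real n) \<longlonglongrightarrow> G"
proof (rule LIMSEQ_I)
  fix r :: real assume "0 < r"
  define B' where "B' = B + \<bar>G\<bar>"
  have B': "0 \<le> B'" using bound[of 0] by (simp add: B'_def)
  \<comment> \<open>The final estimate is \<open>K + \<epsilon> * (1 + B') * n\<close>; this choice
    leaves the other half of \<open>r\<close> for the constant \<open>K\<close>.\<close>
  define \<epsilon> where "\<epsilon> = r / (2 * (1 + B'))"
  have \<epsilon>: "0 < \<epsilon>" "\<epsilon> * (1 + B') = r / 2"
    using \<open>0 < r\<close> B' by (simp_all add: \<epsilon>_def field_simps)
  define D where "D s = real (\<tau> (Suc s)) - real (\<tau> s)" for s
  have D: "0 < D s" for s
    using strict_monoD[OF mono, of s "Suc s"] by (simp add: D_def)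
  define R where "R n = S n - real n * G" for n
  have "\<forall>\<^sub>F s in sequentially. dist ((S (\<tau> (Suc s)) - S (\<tau> s)) / D s) G < \<epsilon> \<and>
      dist (D s / real (\<tau> s)) 0 < \<epsilon> \<and> 1 \<le> s"
    using tendstoD[OF blocks \<epsilon>(1)] tendstoD[OF short \<epsilon>(1)] eventually_ge_at_top[of 1]
    unfolding D_def by eventually_elim simp
  then obtain s0 where s0: "\<And>s. s0 \<le> s \<Longrightarrow>
      \<bar>(S (\<tau> (Suc s)) - S (\<tau> s)) / D s - G\<bar> < \<epsilon> \<and> \<bar>D s / real (\<tau> s)\<bar> < \<epsilon> \<and> 1 \<le> s"
    unfolding eventually_sequentially dist_real_def by auto
  have pos: "0 < real (\<tau> s)" if "s0 \<le> s" for s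
    using strict_mono_imp_increasing[OF mono, of s] s0[OF that] by simp
  have short_block: "D s \<le> \<epsilon> * real (\<tau> s)" if "s0 \<le> s" for s
    using s0[OF that] pos[OF that] D[of s] by (simp add: pos_divide_less_eq)
  have block: "\<bar>R (\<tau> (Suc s)) - R (\<tau> s)\<bar> \<le> \<epsilon> * D s" if "s0 \<le> s" for s
  proof -
    have "R (\<tau> (Suc s)) - R (\<tau> s) = ((S (\<tau> (Suc s)) - S (\<tau> s)) / D s - G) * D s"
      using D[of s] by (simp add: R_def D_def field_simps)
    then have "\<bar>R (\<tau> (Suc s)) - R (\<tau> s)\<bar> = \<bar>(S (\<tau> (Suc s)) - S (\<tau> s)) / D s - G\<bar> * D s"
      using D[of s] by (simp add: abs_mult)
    with s0[OF that] D[of s] show ?thesis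
      by (simp add: mult_right_mono)
  qed
  define K where "K = \<bar>R (\<tau> s0)\<bar>"
  have at_blocks: "\<bar>R (\<tau> s)\<bar> \<le> K + \<epsilon> * real (\<tau> s)" if "s0 \<le> s" for s
    using that
  proof (induction s rule: dec_induct)
    case base
    then show ?case using \<epsilon>(1) by (simp add: K_def)
  next
    case (step s)
    have "\<bar>R (\<tau> (Suc s))\<bar> \<le> \<bar>R (\<tau> s)\<bar> + \<epsilon> * D s"
      using block[of s] step by linarith
    with step show ?case by (simp add: D_def algebra_simps)
  qed
  have R_lipschitz: "\<bar>R (m + k) - R m\<bar> \<le> B' * real k" for m k
  proof (induction k)
    case (Suc k)
    have "R (m + Suc k) - R m = (R (m + k) - R m) + (a (m + k) - G)"
      by (simp add: R_def S_def algebra_simps)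
    with Suc bound[of "m + k"] show ?case
      by (simp add: B'_def algebra_simps)
  qed simp
  have R_bound: "\<bar>R n\<bar> \<le> K + r / 2 * real n" if n: "\<tau> s0 \<le> n" for n
  proof -
    have "\<exists>s. n < \<tau> s"
      using strict_mono_imp_increasing[OF mono, of "Suc n"] by (intro exI[of _ "Suc n"]) simp
    then obtain s' where s': "n < \<tau> s'" "\<And>s. s < s' \<Longrightarrow> \<tau> s \<le> n"
      using exists_least_iff[of "\<lambda>s. n < \<tau> s"] by (auto simp: not_less)
    with n have "s0 < s'"
      using strict_mono_less_eq[OF mono, of s' s0] by (cases "s' \<le> s0") auto
    then obtain s where s: "s' = Suc s" "s0 \<le> s" by (cases s') auto
    then have "\<tau> s \<le> n" using s' by simp
    have "real (n - \<tau> s) \<le> D s"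
      using s' s \<open>\<tau> s \<le> n\<close> by (simp add: D_def of_nat_diff)
    with short_block[OF s(2)] have "real (n - \<tau> s) \<le> \<epsilon> * real (\<tau> s)" by linarith
    then have "B' * real (n - \<tau> s) \<le> B' * (\<epsilon> * real (\<tau> s))"
      using B' by (rule mult_left_mono)
    with R_lipschitz[of "\<tau> s" "n - \<tau> s"] at_blocks[OF s(2)] \<open>\<tau> s \<le> n\<close>
    have "\<bar>R n\<bar> \<le> K + \<epsilon> * (1 + B') * real (\<tau> s)"
      by (simp add: algebra_simps)
    also have "\<dots> \<le> K + r / 2 * real n"
      using \<open>\<tau> s \<le> n\<close> \<open>0 < r\<close> unfolding \<epsilon>(2) by simp
    finally show ?thesis .
  qed
  obtain N where N: "2 * K / r < real N" using reals_Archimedean2 by blast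
  show "\<exists>no. \<forall>n\<ge>no. norm (S n / real n - G) < r"
  proof (intro exI[of _ "max (Suc N) (\<tau> s0)"] allI impI)
    fix n assume n: "max (Suc N) (\<tau> s0) \<le> n"
    then have "0 < real n" "2 * K / r < real n" using N by simp_all
    then have "K < r / 2 * real n" using \<open>0 < r\<close> by (simp add: field_simps)
    with R_bound[of n] n have "\<bar>R n\<bar> < r * real n" by simp
    moreover have "S n / real n - G = R n / real n"
      using \<open>0 < real n\<close> by (simp add: R_def field_simps)
    ultimately show "norm (S n / real n - G) < r"
      using \<open>0 < real n\<close> by (simp add: pos_divide_less_eq)
  qed
qed

section \<open>Sums over one phase\<close>

lemma sum_lessThan_add:
  fixes a :: "nat \<Rightarrow> 'a :: comm_monoid_add"
  shows "(\<Sum>i<m + n. a i) = (\<Sum>i<m. a i) + (\<Sum>i<n. a (m + i))"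
  by (induction n) (simp_all add: add.assoc)

definition phase_sum :: "((nat \<Rightarrow> nat) \<Rightarrow> real) \<Rightarrow> nat \<Rightarrow> real" where
  "phase_sum f p = (\<Sum>i<Suc p + phase_length p. f (main_orbit (phase_start p + i)))"

lemma sum_main_orbit_phase_start:
  "(\<Sum>i<phase_start P. f (main_orbit i)) = (\<Sum>p<P. phase_sum f p)"
  by (induction P)
    (simp_all add: phase_start_Suc sum_lessThan_add phase_sum_def del: add_Suc, simp add: phase_start_def)

lemma prod_decode_triangle: "e \<le> s \<Longrightarrow> prod_decode (triangle s + e) = (e, s - e)"
  using prod_encode_inverse[of "(e, s - e)"] by (simp add: prod_encode_def)

lemma Suc_triangle_le: "e \<le> s \<Longrightarrow> Suc (triangle s + e) \<le> (Suc s)\<^sup>2"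
proof -
  have "triangle s \<le> s * Suc s" for s by (simp add: triangle_def)
  moreover assume "e \<le> s"
  ultimately show ?thesis
    using add_mono[of "triangle s" "s * Suc s" e s] by (simp add: power2_eq_square)
qed

lemma phase_length_triangle:
  "e \<le> s \<Longrightarrow> phase_length (triangle s + e) = Suc s ^ 4 div 2 ^ e"
  by (simp add: phase_length_def prod_decode_triangle)

lemma phase_length_triangle_bounds:
  assumes "e \<le> s"
  shows "real (phase_length (triangle s + e)) \<le> real (Suc s) ^ 4 * (1/2) ^ e"
    and "real (Suc s) ^ 4 * (1/2) ^ e - 1 \<le> real (phase_length (triangle s + e))"
proof -
  let ?L = "phase_length (triangle s + e)"
  have L: "?L = Suc s ^ 4 div 2 ^ e" by (rule phase_length_triangle[OF assms])
  have "real (Suc s) ^ 4 * (1/2) ^ e = real (Suc s ^ 4) / real (2 ^ e)"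
    by (simp add: power_one_over field_simps)
  moreover have "real ?L \<le> real (Suc s ^ 4) / real (2 ^ e)"
    unfolding L by (rule of_nat_div_le_of_nat)
  moreover have "real (Suc s ^ 4) / real (2 ^ e) - real ?L \<le> 1"
  proof -
    have "real (Suc s ^ 4) = real ?L * real (2 ^ e) + real (Suc s ^ 4 mod 2 ^ e)"
      unfolding L by (metis div_mult_mod_eq of_nat_add of_nat_mult)
    moreover have "real (Suc s ^ 4 mod 2 ^ e) \<le> real (2 ^ e)"
      by (simp add: less_imp_le)
    ultimately show ?thesis
      by (simp add: field_simps del: of_nat_power of_nat_Suc)
  qed
  ultimately show "real ?L \<le> real (Suc s) ^ 4 * (1/2) ^ e"
    "real (Suc s) ^ 4 * (1/2) ^ e - 1 \<le> real ?L"
    by linarith+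
qed

lemma sum_abs_near_le:
  fixes h :: "nat \<Rightarrow> real"
  assumes "\<And>l. \<bar>h l - g\<bar> \<le> C" "\<And>l. N \<le> l \<Longrightarrow> \<bar>h l - g\<bar> \<le> \<epsilon>" "0 \<le> \<epsilon>"
  shows "\<bar>(\<Sum>l<L. h (Suc l)) - real L * g\<bar> \<le> C * real N + \<epsilon> * real L"
proof -
  have "0 \<le> C" using assms(1)[of 0] by linarith
  have "\<bar>(\<Sum>l<L. h (Suc l)) - real L * g\<bar> \<le> C * real (min L N) + \<epsilon> * real L"
  proof (induction L)
    case (Suc L)
    have "\<bar>(\<Sum>l<Suc L. h (Suc l)) - real (Suc L) * g\<bar>
        \<le> \<bar>(\<Sum>l<L. h (Suc l)) - real L * g\<bar> + \<bar>h (Suc L) - g\<bar>"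
      by (simp add: algebra_simps)
    with Suc.IH show ?case
      using assms(1)[of "Suc L"] assms(2)[of "Suc L"] \<open>0 \<le> \<epsilon>\<close>
      by (cases "N \<le> L") (simp_all add: min_absorb1 min_absorb2 algebra_simps)
  qed simp
  also have "\<dots> \<le> C * real N + \<epsilon> * real L"
    using \<open>0 \<le> C\<close> by (simp add: mult_left_mono)
  finally show ?thesis .
qed

text \<open>The averaging argument uses only these properties, which hold for continuous functions
  and for the constant 1. Convergence is uniform in \<open>p\<close>, as the counter behind the word
  changes from phase to phase.\<close>

locale test_function =
  fixes f :: "(nat \<Rightarrow> nat) \<Rightarrow> real" and B :: real
  assumes bound: "\<And>i. \<bar>f (main_orbit i)\<bar> \<le> B"
    and bound_spike: "\<And>c. \<bar>f (spike c)\<bar> \<le> B"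
    and bound_word: "\<And>c l p. \<bar>f (word_state c l p)\<bar> \<le> B"
    and continuous: "\<And>c \<epsilon>. 0 < \<epsilon> \<Longrightarrow>
      \<exists>N. \<forall>l\<ge>N. \<forall>p. \<bar>f (word_state c l p) - f (spike c)\<bar> \<le> \<epsilon>"
begin

lemma B_nonneg: "0 \<le> B"
  using bound[of 0] by linarith

text \<open>The share of guess \<open>e\<close> in the diagonal \<open>s\<close>; the value 0 for
  \<open>e > s\<close> turns sums over a diagonal into series over all \<open>e\<close>.\<close>

definition avg :: "nat \<Rightarrow> nat \<Rightarrow> real" where
  "avg e s = (if e \<le> s then phase_sum f (triangle s + e) / real (Suc s) ^ 4 else 0)"

text \<open>The first \<open>Suc p\<close> steps wait; after them \<open>Suc l\<close> is the length
  of the word that remains. Length 0 does not occur, as that state already belongs to the next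
  phase.\<close>

lemma phase_sum_split:
  "phase_sum f p = (\<Sum>i<Suc p. f (main_orbit (phase_start p + i))) +
     (\<Sum>l<phase_length p. f (word_state (phase_code p) (Suc l) (Suc p)))"
proof -
  have "(\<Sum>q<phase_length p. f (main_orbit (phase_start p + (Suc p + q)))) =
      (\<Sum>q<phase_length p. f (word_state (phase_code p) (Suc (phase_length p - Suc q)) (Suc p)))"
    by (intro sum.cong refl) (simp add: main_orbit_word_state Suc_diff_Suc del: add_Suc)
  also have "\<dots> = (\<Sum>l<phase_length p. f (word_state (phase_code p) (Suc l) (Suc p)))"
    by (rule sum.nat_diff_reindex)
  finally show ?thesis
    by (simp only: phase_sum_def sum_lessThan_add)
qed

lemma abs_sum_orbit_le: "\<bar>\<Sum>i<n. f (main_orbit (m + i))\<bar> \<le> B * real n"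
proof -
  have "\<bar>\<Sum>i<n. f (main_orbit (m + i))\<bar> \<le> (\<Sum>i<n. B)"
    by (intro order_trans[OF sum_abs] sum_mono bound)
  then show ?thesis by (simp add: mult.commute)
qed

text \<open>
  Divided by \<open>(s + 1)\<^sup>4\<close>, the waiting time \<open>p + 1 \<le> (s + 1)\<^sup>2\<close> of a phase is at most
  \<open>1 / (s + 1)\<^sup>2\<close>, and \<open>e \<le> s\<close> turns this into a summable bound for Tannery's theorem.
\<close>

lemma avg_bound: "\<bar>avg e s\<bar> \<le> B * (inverse (real (Suc e) ^ 2) + (1/2) ^ e)"
proof (cases "e \<le> s")
  case True
  let ?p = "triangle s + e" and ?x = "real (Suc s)"
  have "\<bar>phase_sum f ?p\<bar> \<le> B * real (Suc ?p + phase_length ?p)"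
    unfolding phase_sum_def by (rule abs_sum_orbit_le)
  also have "\<dots> \<le> B * (?x ^ 2 + ?x ^ 4 * (1/2) ^ e)"
  proof (rule mult_left_mono[OF _ B_nonneg])
    have "real (Suc ?p) \<le> real ((Suc s)\<^sup>2)"
      using Suc_triangle_le[OF True] by (rule of_nat_mono)
    with phase_length_triangle_bounds(1)[OF True]
    show "real (Suc ?p + phase_length ?p) \<le> ?x ^ 2 + ?x ^ 4 * (1/2) ^ e"
      by simp
  qed
  finally have "\<bar>phase_sum f ?p\<bar> \<le> B * (?x ^ 2 + ?x ^ 4 * (1/2) ^ e)" .
  then have "\<bar>avg e s\<bar> \<le> B * (?x ^ 2 + ?x ^ 4 * (1/2) ^ e) / ?x ^ 4"
    using True by (simp add: avg_def divide_right_mono)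
  also have "\<dots> = B * (inverse (?x ^ 2) + (1/2) ^ e)"
    by (simp add: field_simps power4_eq_xxxx power2_eq_square del: of_nat_Suc)
  also have "\<dots> \<le> B * (inverse (real (Suc e) ^ 2) + (1/2) ^ e)"
    using True B_nonneg
    by (intro mult_left_mono add_mono le_imp_inverse_le power_mono) simp_all
  finally show ?thesis .
qed (use B_nonneg in \<open>simp add: avg_def\<close>)

text \<open>From some phase on the code of guess \<open>e\<close> is final, and in each phase all
  but boundedly many word states are \<open>\<epsilon>\<close>-close to the spike. Waiting time,
  short words and rounding add an error of order \<open>(s + 1)^2\<close>, negligible against
  \<open>(s + 1)^4\<close>.\<close>

lemma avg_limit: "avg e \<longlonglongrightarrow> (1/2) ^ e * f (spike (limit_code e))"
proof (rule LIMSEQ_I)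
  fix r :: real assume "0 < r"
  let ?c = "limit_code e" let ?g = "f (spike ?c)"
  define \<epsilon> where "\<epsilon> = r / 2"
  have "0 < \<epsilon>" using \<open>0 < r\<close> by (simp add: \<epsilon>_def)
  from continuous[OF this, of ?c] obtain N
    where N: "\<And>l p. N \<le> l \<Longrightarrow> \<bar>f (word_state ?c l p) - ?g\<bar> \<le> \<epsilon>" by blast
  obtain z where z: "\<And>p. z \<le> p \<Longrightarrow> pfst p = e \<Longrightarrow> phase_code p = ?c"
  proof (cases "\<forall>z. alive e z")
    case True
    then show thesis by (intro that[of 0]) (simp add: phase_code_def limit_code_def)
  next
    case False
    then obtain z where "\<not> alive e z" by blast
    then show thesis
      by (intro that[of "Suc z"]) (auto simp: phase_code_def limit_code_def Suc_le_eq)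
  qed
  \<comment> \<open>\<open>K\<close> collects \<open>B\<close> for the waiting time,
    \<open>2 * B * N\<close> for the short words and \<open>B\<close> for rounding, each multiplied
    by \<open>x\<^sup>2\<close>.\<close>
  define K where "K = 2 * B * real (Suc N)"
  have near: "\<bar>avg e s - (1/2) ^ e * ?g\<bar> \<le> K / real (Suc s) + \<epsilon>" if s: "e \<le> s" "z \<le> s" for s
  proof -
    define p where "p = triangle s + e"
    define x where "x = real (Suc s)"
    have x: "1 \<le> x" by (simp add: x_def)
    have "s \<le> triangle s" by (cases s) simp_all
    with s have p: "phase_code p = ?c"
      by (intro z) (simp_all add: p_def prod_decode_triangle)
    let ?L = "real (phase_length p)"
    have L: "?L \<le> x ^ 4 * (1/2) ^ e" "x ^ 4 * (1/2) ^ e - 1 \<le> ?L"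
      using phase_length_triangle_bounds[OF s(1)] by (simp_all add: p_def x_def)
    have word: "\<bar>(\<Sum>l<phase_length p. f (word_state ?c (Suc l) (Suc p))) - ?L * ?g\<bar>
        \<le> (2 * B) * real N + \<epsilon> * ?L"
    proof (rule sum_abs_near_le)
      show "\<bar>f (word_state ?c l (Suc p)) - ?g\<bar> \<le> 2 * B" for l
        using bound_word[of ?c l "Suc p"] bound_spike[of ?c] by linarith
    qed (use N \<open>0 < \<epsilon>\<close> in auto)
    have "\<bar>\<Sum>i<Suc p. f (main_orbit (phase_start p + i))\<bar> \<le> B * x\<^sup>2"
    proof -
      have "real (Suc p) \<le> real ((Suc s)\<^sup>2)"
        unfolding p_def using Suc_triangle_le[OF s(1)] by (rule of_nat_mono)
      then have "B * real (Suc p) \<le> B * x\<^sup>2"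
        using B_nonneg by (intro mult_left_mono) (simp_all add: x_def)
      with abs_sum_orbit_le[where n = "Suc p" and m = "phase_start p"] show ?thesis by linarith
    qed
    moreover have "\<bar>?L * ?g - x ^ 4 * (1/2) ^ e * ?g\<bar> \<le> B"
    proof -
      have "\<bar>?L - x ^ 4 * (1/2) ^ e\<bar> * \<bar>?g\<bar> \<le> 1 * B"
        using L bound_spike by (intro mult_mono) simp_all
      then show ?thesis
        by (simp only: abs_mult[symmetric] left_diff_distrib mult_1_left)
    qed
    moreover have "\<epsilon> * ?L \<le> \<epsilon> * x ^ 4"
    proof -
      have "x ^ 4 * (1/2) ^ e \<le> x ^ 4 * 1"
        by (intro mult_left_mono power_le_one) (simp_all add: x_def)
      with L(1) \<open>0 < \<epsilon>\<close> show ?thesis by (intro mult_left_mono) simp_all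
    qed
    ultimately have "\<bar>phase_sum f p - x ^ 4 * (1/2) ^ e * ?g\<bar> \<le> B * x\<^sup>2 + (2 * B * real N + B) + \<epsilon> * x ^ 4"
      using word unfolding phase_sum_split p by linarith
    also have "\<dots> \<le> K * x\<^sup>2 + \<epsilon> * x ^ 4"
    proof -
      have "(2 * B * real N + B) * 1 \<le> (2 * B * real N + B) * x\<^sup>2"
        using B_nonneg x by (intro mult_left_mono one_le_power) simp_all
      then show ?thesis by (simp add: K_def algebra_simps)
    qed
    finally have "\<bar>phase_sum f p - x ^ 4 * (1/2) ^ e * ?g\<bar> / x ^ 4 \<le> (K * x\<^sup>2 + \<epsilon> * x ^ 4) / x ^ 4"
      by (rule divide_right_mono) simp
    moreover have "avg e s - (1/2) ^ e * ?g = (phase_sum f p - x ^ 4 * (1/2) ^ e * ?g) / x ^ 4"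
      using s x by (simp add: avg_def p_def x_def field_simps del: of_nat_Suc)
    moreover have "(K * x\<^sup>2 + \<epsilon> * x ^ 4) / x ^ 4 = K / x\<^sup>2 + \<epsilon>"
      using x by (simp add: field_simps power4_eq_xxxx power2_eq_square)
    moreover have "K / x\<^sup>2 \<le> K / x"
      using x B_nonneg by (intro divide_left_mono) (simp_all add: K_def power2_eq_square)
    ultimately show ?thesis
      using x by (simp add: abs_divide x_def)
  qed
  obtain M where M: "2 * K / r < real M" using reals_Archimedean2 by blast
  show "\<exists>no. \<forall>s\<ge>no. norm (avg e s - (1/2) ^ e * ?g) < r"
  proof (intro exI[of _ "max M (max e z)"] allI impI)
    fix s assume s: "max M (max e z) \<le> s"
    then have "2 * K / r < real (Suc s)" using M by simp
    then have "K / real (Suc s) < r / 2"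
      using \<open>0 < r\<close> by (simp add: field_simps del: of_nat_Suc)
    moreover have "\<bar>avg e s - (1/2) ^ e * ?g\<bar> \<le> K / real (Suc s) + \<epsilon>"
      using s by (intro near) simp_all
    ultimately show "norm (avg e s - (1/2) ^ e * ?g) < r"
      unfolding \<epsilon>_def real_norm_def by linarith
  qed
qed

lemma summable_bound: "summable (\<lambda>e. B * (inverse (real (Suc e) ^ 2) + (1/2) ^ e))"
proof (intro summable_mult summable_add)
  show "summable (\<lambda>e. inverse (real (Suc e) ^ 2))"
    using inverse_power_summable[of 2, where 'a = real] by (subst summable_Suc_iff) simp
qed (simp add: summable_geometric)

lemma superblock_limit:
  "(\<lambda>s. (\<Sum>e\<le>s. phase_sum f (triangle s + e)) / real (Suc s) ^ 4)
     \<longlonglongrightarrow> (\<Sum>e. (1/2) ^ e * f (spike (limit_code e)))"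
proof -
  have "(\<lambda>s. \<Sum>e. avg e s) \<longlonglongrightarrow> (\<Sum>e. (1/2) ^ e * f (spike (limit_code e)))"
    using tannerys_theorem[OF avg_limit _ summable_bound] avg_bound
    by (simp add: case_prod_unfold)
  moreover have "(\<Sum>e. avg e s) = (\<Sum>e\<le>s. phase_sum f (triangle s + e)) / real (Suc s) ^ 4" for s
    by (subst suminf_finite[of "{..s}"]) (simp_all add: avg_def sum_divide_distrib)
  ultimately show ?thesis by simp
qed

end

text \<open>For the constant function phase sums are phase lengths, so the results on averages also
  give the lengths of the superblocks.\<close>

interpretation one: test_function "\<lambda>_. 1" 1
  by unfold_locales auto

text \<open>
  A superblock treats each of the guesses \<open>0, \<dots>, s\<close> once, because the Cantor pairing function runs
  through the diagonals.
\<close>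

definition superblock :: "nat \<Rightarrow> nat" where
  "superblock s = phase_start (triangle s)"

lemma sum_superblock:
  "(\<Sum>i<superblock (Suc s). f (main_orbit i)) - (\<Sum>i<superblock s. f (main_orbit i))
     = (\<Sum>e\<le>s. phase_sum f (triangle s + e))"
  unfolding superblock_def sum_main_orbit_phase_start triangle_Suc sum_lessThan_add
  by (simp only: lessThan_Suc_atMost add_diff_cancel_left')

text \<open>The phase of guess 0 alone contains \<open>(s + 1)^4\<close> deletions.\<close>

lemma superblock_Suc_ge: "superblock s + Suc s ^ 4 \<le> superblock (Suc s)"
proof -
  have "phase_start p \<le> phase_start (p + k)" for p k
    by (induction k) (simp_all add: phase_start_Suc)
  from this[of "Suc (triangle s)" s]
  have "phase_start (Suc (triangle s)) \<le> superblock (Suc s)"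
    by (simp add: superblock_def)
  then show ?thesis
    using phase_length_triangle[of 0 s] by (simp add: phase_start_Suc superblock_def)
qed

text \<open>The factor 2 is the total weight of all guesses, the sum of \<open>2^-e\<close>.\<close>

lemma superblock_length_limit:
  "(\<lambda>s. (real (superblock (Suc s)) - real (superblock s)) / real (Suc s) ^ 4) \<longlonglongrightarrow> 2"
proof -
  have "(\<Sum>e. (1/2::real) ^ e * 1) = 2"
    using suminf_geometric[of "1/2::real"] by simp
  then show ?thesis
    using one.superblock_limit sum_superblock[of "\<lambda>_. 1"] by simp
qed

text \<open>Fourth powers add up to a fifth power: \<open>(s + 1)^5 - s^5\<close> is at most
  \<open>5 * (s + 1)^4\<close>.\<close>

lemma superblock_ge: "s ^ 5 \<le> 5 * superblock s"
proof (induction s)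
  case (Suc s)
  have "Suc s ^ 5 \<le> s ^ 5 + 5 * Suc s ^ 4"
    by (simp add: eval_nat_numeral algebra_simps)
  with Suc superblock_Suc_ge[of s] show ?case by linarith
qed simp

lemma superblock_length_ratio:
  "(\<lambda>s. (real (superblock (Suc s)) - real (superblock s)) / real (superblock s)) \<longlonglongrightarrow> 0"
proof -
  have "(\<lambda>s. real (Suc s) ^ 4 / real (superblock s)) \<longlonglongrightarrow> 0"
  \<comment> \<open>\<open>80 = 2^4 * 5\<close>, from \<open>Suc s \<le> 2 * s\<close> and
    \<open>superblock_ge\<close>.\<close>
  proof (rule tendsto_sandwich[where f = "\<lambda>_. 0" and h = "\<lambda>s. 80 / real s"])
    show "\<forall>\<^sub>F s in sequentially. real (Suc s) ^ 4 / real (superblock s) \<le> 80 / real s"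
      using eventually_ge_at_top[of 1]
    proof eventually_elim
      case (elim s)
      have "real (Suc s) ^ 4 \<le> (2 * real s) ^ 4"
        using elim by (intro power_mono) simp_all
      moreover have "real s ^ 5 \<le> 5 * real (superblock s)"
        using superblock_ge[of s] by (metis of_nat_le_iff of_nat_mult of_nat_numeral of_nat_power)
      moreover have "0 < real s ^ 5" using elim by simp
      ultimately have "real (Suc s) ^ 4 / real (superblock s) \<le> (2 * real s) ^ 4 / (real s ^ 5 / 5)"
        by (intro frac_le) simp_all
      also have "\<dots> = 80 / real s"
        using elim by (simp add: field_simps eval_nat_numeral)
      finally show ?case .
    qed
    show "(\<lambda>s. 80 / real s) \<longlonglongrightarrow> 0"
      by (rule lim_const_over_n)
  qed (simp_all add: always_eventually)
  from tendsto_mult[OF superblock_length_limit this] show ?thesis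
    by (simp del: of_nat_Suc)
qed

lemma (in test_function) main_orbit_average:
  "(\<lambda>n. (\<Sum>i<n. f (main_orbit i)) / real n) \<longlonglongrightarrow> (\<Sum>e. (1/2) ^ e * f (spike (limit_code e))) / 2"
proof (rule cesaro_of_blocks[where \<tau> = superblock])
  show "strict_mono superblock"
  proof (rule strict_mono_Suc_iff[THEN iffD2, rule_format])
    show "superblock s < superblock (Suc s)" for s
    proof -
      have "0 < Suc s ^ 4" by simp
      with superblock_Suc_ge[of s] show ?thesis by linarith
    qed
  qed
  show "(\<lambda>s. ((\<Sum>i<superblock (Suc s). f (main_orbit i)) - (\<Sum>i<superblock s. f (main_orbit i))) /
      (real (superblock (Suc s)) - real (superblock s)))
    \<longlonglongrightarrow> (\<Sum>e. (1/2) ^ e * f (spike (limit_code e))) / 2"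
    using tendsto_divide[OF superblock_limit superblock_length_limit]
    by (simp add: sum_superblock del: of_nat_Suc)
qed (rule bound superblock_length_ratio)+

section \<open>Topology and measures on symbolic spaces\<close>

interpretation symb: Metric_space "symb_space k" symb_dist for k
  by (rule Metric_space_symb_space)

lemma symb_dist_less_iff:
  assumes "0 < r"
  shows "symb_dist x y < r \<longleftrightarrow> (\<forall>l. r \<le> inverse (2 ^ l) \<longrightarrow> x l = y l)"
proof (cases "x = y")
  case True
  with assms show ?thesis by (simp add: symb_dist_self)
next
  case False
  define m where "m = (LEAST n. x n \<noteq> y n)"
  have "\<exists>n. x n \<noteq> y n" using False by blast
  then have m: "x m \<noteq> y m" "\<And>l. l < m \<Longrightarrow> x l = y l"
    unfolding m_def by (rule LeastI_ex) (auto dest: not_less_Least)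
  have dist: "symb_dist x y = inverse (2 ^ m)"
    using False by (simp add: symb_dist_def m_def)
  have "l < m" if "inverse (2 ^ m) < r" "r \<le> inverse (2 ^ l)" for l
  proof (rule ccontr)
    assume "\<not> l < m"
    then have "inverse (2 ^ l) \<le> (inverse (2 ^ m) :: real)"
      by (simp add: power_increasing le_imp_inverse_le)
    with that show False by linarith
  qed
  with m show ?thesis
    unfolding dist by (meson not_le)
qed

definition cylinder :: "nat \<Rightarrow> (nat \<Rightarrow> nat) \<Rightarrow> nat \<Rightarrow> (nat \<Rightarrow> nat) set" where
  "cylinder k x n = {y \<in> symb_space k. \<forall>i<n. y i = x i}"

lemma topspace_symb_topology [simp]: "topspace (symb_topology k) = symb_space k"
  by (simp add: symb_topology_def)

lemma openin_symb_topology_iff: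
  "openin (symb_topology k) U \<longleftrightarrow> U \<subseteq> symb_space k \<and> (\<forall>x\<in>U. \<exists>n. cylinder k x n \<subseteq> U)"
proof -
  have "(\<exists>r>0. symb.mball k x r \<subseteq> U) \<longleftrightarrow> (\<exists>n. cylinder k x n \<subseteq> U)"
    if x: "x \<in> symb_space k" for x
  proof
    assume "\<exists>r>0. symb.mball k x r \<subseteq> U"
    then obtain r where r: "0 < r" "symb.mball k x r \<subseteq> U" by blast
    obtain n where n: "(1/2) ^ n < r"
      using real_arch_pow_inv[OF r(1), of "1/2"] by auto
    have "l < n" if "r \<le> inverse (2 ^ l)" for l
    proof (rule ccontr)
      assume "\<not> l < n"
      then have "inverse (2 ^ l) \<le> (inverse (2 ^ n) :: real)"
        by (simp add: power_increasing le_imp_inverse_le)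
      with that n show False by (simp add: power_one_over inverse_eq_divide)
    qed
    then have "cylinder k x n \<subseteq> symb.mball k x r"
      using x by (auto simp: cylinder_def symb_dist_less_iff[OF r(1)])
    with r show "\<exists>n. cylinder k x n \<subseteq> U" by blast
  next
    assume "\<exists>n. cylinder k x n \<subseteq> U"
    then obtain n where n: "cylinder k x n \<subseteq> U" by blast
    have "inverse (2 ^ n) \<le> (inverse (2 ^ l) :: real)" if "l < n" for l
      using that by (simp add: power_increasing le_imp_inverse_le)
    then have "symb.mball k x (inverse (2 ^ n)) \<subseteq> cylinder k x n"
      by (auto simp: cylinder_def symb_dist_less_iff)
    with n show "\<exists>r>0. symb.mball k x r \<subseteq> U"
      by (intro exI[of _ "inverse (2 ^ n)"]) auto
  qed
  then show ?thesis
    unfolding symb_topology_def symb.openin_mtopology by blast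
qed

lemma openin_cylinder: "openin (symb_topology k) (cylinder k x n)"
proof -
  have "cylinder k y n \<subseteq> cylinder k x n" if "y \<in> cylinder k x n" for y
    using that by (auto simp: cylinder_def)
  moreover have "cylinder k x n \<subseteq> symb_space k"
    by (auto simp: cylinder_def)
  ultimately show ?thesis
    unfolding openin_symb_topology_iff by blast
qed

text \<open>By Tychonoff's theorem the product of the finite discrete alphabets is compact. Every
  metrically open set is a union of cylinders and so is open in the product.\<close>

lemma compact_space_symb_topology: "compact_space (symb_topology k)"
proof -
  let ?P = "product_topology (\<lambda>_::nat. discrete_topology {..<k}) UNIV"
  have top: "topspace ?P = symb_space k"
    by (auto simp: symb_space_def PiE_def)
  have cyl: "openin ?P (cylinder k x n)" if "x \<in> symb_space k" for x n
  proof -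
    have "openin ?P (PiE UNIV (\<lambda>i. if i < n then {x i} else {..<k}))"
      using that by (intro product_topology_basis)
        (auto simp: symb_space_def intro: finite_subset[of _ "{..<n}"])
    moreover have "PiE UNIV (\<lambda>i. if i < n then {x i} else {..<k}) = cylinder k x n"
      using that by (auto simp: cylinder_def symb_space_def PiE_def Pi_def split: if_splits)
    ultimately show ?thesis by simp
  qed
  have open_prod: "openin ?P U" if U: "openin (symb_topology k) U" for U
  proof -
    have "U = \<Union>{cylinder k x n |x n. x \<in> U \<and> cylinder k x n \<subseteq> U}"
    proof -
      have "x \<in> cylinder k x n" if "x \<in> U" for x n
        using U that by (auto simp: cylinder_def openin_symb_topology_iff)
      with U show ?thesis unfolding openin_symb_topology_iff by blast
    qed
    moreover have "openin ?P (\<Union>{cylinder k x n |x n. x \<in> U \<and> cylinder k x n \<subseteq> U})"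
      using U cyl by (intro openin_Union) (auto simp: openin_symb_topology_iff)
    ultimately show ?thesis by simp
  qed
  have "compact_space ?P"
    by (simp add: compact_space_product_topology compact_space_discrete_topology)
  then show ?thesis
    unfolding compact_space_def compactin_def top topspace_symb_topology
    using open_prod by (metis order_refl)
qed

lemma continuous_map_symb_bounded:
  assumes "continuous_map (symb_topology k) euclideanreal f"
  shows "\<exists>B. \<forall>x\<in>symb_space k. \<bar>f x\<bar> \<le> B"
proof -
  have "compactin euclideanreal (f ` symb_space k)"
    using image_compactin[OF _ assms] compact_space_symb_topology[of k]
    by (simp add: compact_space_def)
  then have "bounded (f ` symb_space k)"
    by (simp add: compact_imp_bounded)
  then show ?thesis
    by (auto simp: bounded_iff)
qed

lemma continuous_map_symb_near:
  assumes f: "continuous_map (symb_topology k) euclideanreal f"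
    and x: "x \<in> symb_space k" and "0 < \<epsilon>"
  shows "\<exists>n. \<forall>y\<in>cylinder k x n. \<bar>f y - f x\<bar> < \<epsilon>"
proof -
  have "openin (symb_topology k) {y \<in> symb_space k. f y \<in> ball (f x) \<epsilon>}"
    using openin_continuous_map_preimage[OF f, of "ball (f x) \<epsilon>"] by simp
  moreover have "x \<in> {y \<in> symb_space k. f y \<in> ball (f x) \<epsilon>}"
    using x \<open>0 < \<epsilon>\<close> by simp
  ultimately obtain n where "cylinder k x n \<subseteq> {y \<in> symb_space k. f y \<in> ball (f x) \<epsilon>}"
    unfolding openin_symb_topology_iff by blast
  then show ?thesis
    by (intro exI[of _ n]) (auto simp: dist_real_def abs_minus_commute)
qed

section \<open>Borel sets, integrals and probability measures\<close>

lemma space_symb_borel [simp]: "space (symb_borel k) = symb_space k"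
  unfolding symb_borel_def by (rule space_measure_of) (use openin_subset in fastforce)

lemma sets_symb_borel: "sets (symb_borel k) = sigma_sets (symb_space k) {U. openin (symb_topology k) U}"
  unfolding symb_borel_def by (rule sets_measure_of) (use openin_subset in fastforce)

lemma openin_sets_symb_borel: "openin (symb_topology k) U \<Longrightarrow> U \<in> sets (symb_borel k)"
  unfolding sets_symb_borel by (rule sigma_sets.Basic) simp

lemma borel_prob_space:
  assumes "borel_prob k \<mu>"
  shows "space \<mu> = symb_space k"
  using assms sets_eq_imp_space_eq[of \<mu> "symb_borel k"] by (simp add: borel_prob_def)

lemma continuous_map_symb_measurable:
  assumes f: "continuous_map (symb_topology k) euclideanreal f"
  shows "f \<in> borel_measurable (symb_borel k)"
proof (rule borel_measurableI)
  fix S :: "real set" assume "open S"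
  then have "openin (symb_topology k) {x \<in> symb_space k. f x \<in> S}"
    using openin_continuous_map_preimage[OF f, of S] by simp
  moreover have "f -` S \<inter> space (symb_borel k) = {x \<in> symb_space k. f x \<in> S}"
    by auto
  ultimately show "f -` S \<inter> space (symb_borel k) \<in> sets (symb_borel k)"
    by (simp add: openin_sets_symb_borel)
qed

lemma continuous_map_symb_integrable:
  assumes f: "continuous_map (symb_topology k) euclideanreal f" and \<mu>: "borel_prob k \<mu>"
  shows "integrable \<mu> f"
proof -
  interpret prob_space \<mu> using \<mu> by (simp add: borel_prob_def)
  obtain B where "\<And>x. x \<in> symb_space k \<Longrightarrow> \<bar>f x\<bar> \<le> B"
    using continuous_map_symb_bounded[OF f] by blast
  moreover have "f \<in> borel_measurable \<mu>"
    using continuous_map_symb_measurable[OF f] \<mu> by (simp add: borel_prob_def cong: measurable_cong_sets)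
  ultimately show ?thesis
    by (intro integrable_const_bound[of _ B]) (auto simp: borel_prob_space[OF \<mu>])
qed

text \<open>Cylinders are clopen: membership of \<open>y\<close> is decided by its first
  \<open>n\<close> letters. This makes their measures integrals of continuous functions.\<close>

lemma continuous_map_indicator_cylinder:
  "continuous_map (symb_topology k) euclideanreal (indicator (cylinder k x n))"
  unfolding continuous_map_def openin_symb_topology_iff
proof (intro conjI allI impI ballI)
  fix U :: "real set" and y
  assume y: "y \<in> {y \<in> topspace (symb_topology k). indicator (cylinder k x n) y \<in> U}"
  have eq: "indicator (cylinder k x n) z = (indicator (cylinder k x n) y :: real)"
    if "z \<in> cylinder k y n" for z
  proof -
    have "z \<in> cylinder k x n \<longleftrightarrow> y \<in> cylinder k x n"
      using that y by (auto simp: cylinder_def)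
    then show ?thesis by (simp add: indicator_def)
  qed
  have "cylinder k y n \<subseteq> {y \<in> topspace (symb_topology k). indicator (cylinder k x n) y \<in> U}"
  proof
    fix z assume z: "z \<in> cylinder k y n"
    then have "z \<in> symb_space k" by (simp add: cylinder_def)
    with eq[OF z] y show "z \<in> {y \<in> topspace (symb_topology k). indicator (cylinder k x n) y \<in> U}"
      by simp
  qed
  then show "\<exists>n'. cylinder k y n' \<subseteq> {y \<in> topspace (symb_topology k). indicator (cylinder k x n) y \<in> U}"
    by blast
qed auto

lemma countable_cylinders: "countable {cylinder k x n |x n. True}"
proof -
  have "{cylinder k x n |x n. True} \<subseteq> (\<lambda>(w, n). cylinder k (\<lambda>i. w ! i) n) ` UNIV"
  proof clarify
    fix x :: "nat \<Rightarrow> nat" and n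
    have "(\<forall>i<n. y i = map x [0..<n] ! i) \<longleftrightarrow> (\<forall>i<n. y i = x i)" for y
      by simp
    then have "cylinder k x n = cylinder k (\<lambda>i. map x [0..<n] ! i) n"
      unfolding cylinder_def by blast
    then show "cylinder k x n \<in> (\<lambda>(w, n). cylinder k (\<lambda>i. w ! i) n) ` UNIV"
      by (intro image_eqI[of _ _ "(map x [0..<n], n)"]) (simp_all only: prod.case UNIV_I)
  qed
  then show ?thesis
    by (rule countable_subset) simp
qed

text \<open>Integrals of continuous functions give the measures of cylinders, and these form a
  countable generator closed under intersection.\<close>

lemma borel_prob_eqI:
  assumes \<mu>: "borel_prob k \<mu>" and \<nu>: "borel_prob k \<nu>"
    and eq: "\<And>f :: (nat \<Rightarrow> nat) \<Rightarrow> real. continuous_map (symb_topology k) euclideanreal f \<Longrightarrow>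
      integral\<^sup>L \<mu> f = integral\<^sup>L \<nu> f"
  shows "\<mu> = \<nu>"
proof -
  interpret \<mu>: prob_space \<mu> using \<mu> by (simp add: borel_prob_def)
  interpret \<nu>: prob_space \<nu> using \<nu> by (simp add: borel_prob_def)
  let ?E = "{cylinder k x n |x n. True}"
  have sigma: "sets (symb_borel k) = sigma_sets (symb_space k) ?E"
    unfolding sets_symb_borel
  proof (rule sigma_sets_eqI)
    fix U assume "U \<in> {U. openin (symb_topology k) U}"
    then have U: "U \<subseteq> symb_space k" "\<And>x. x \<in> U \<Longrightarrow> \<exists>n. cylinder k x n \<subseteq> U"
      by (simp_all add: openin_symb_topology_iff)
    have "U = \<Union>{C \<in> ?E. C \<subseteq> U}"
    proof
      show "U \<subseteq> \<Union>{C \<in> ?E. C \<subseteq> U}"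
      proof
        fix x assume "x \<in> U"
        with U(2) obtain n where "cylinder k x n \<subseteq> U" by blast
        moreover have "x \<in> cylinder k x n"
          using U(1) \<open>x \<in> U\<close> by (auto simp: cylinder_def)
        ultimately show "x \<in> \<Union>{C \<in> ?E. C \<subseteq> U}" by blast
      qed
    qed blast
    moreover have "\<Union>{C \<in> ?E. C \<subseteq> U} \<in> sigma_sets (symb_space k) ?E"
    proof (rule sigma_sets_UNION)
      show "countable {C \<in> ?E. C \<subseteq> U}"
        by (rule countable_subset[OF _ countable_cylinders]) blast
    qed (blast intro: sigma_sets.Basic)
    ultimately show "U \<in> sigma_sets (symb_space k) ?E" by simp
  qed (auto intro: openin_cylinder)
  show ?thesis
  proof (rule measure_eqI_generator_eq[where E = ?E and \<Omega> = "symb_space k" and A = "\<lambda>_. symb_space k"])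
    show "Int_stable ?E"
    proof (rule Int_stableI)
      fix C D assume "C \<in> ?E" "D \<in> ?E"
      then obtain x n y m where CD: "C = cylinder k x n" "D = cylinder k y m" by blast
      show "C \<inter> D \<in> ?E"
      proof (cases "C \<inter> D = {}")
        case True
        \<comment> \<open>The letter \<open>k\<close> is outside the alphabet, so the empty set
          counts as a cylinder.\<close>
        have "cylinder k (\<lambda>_. k) 1 = {}"
          by (auto simp: cylinder_def symb_space_def)
        with True show ?thesis by blast
      next
        case False
        then obtain z where "z \<in> C \<inter> D" by blast
        then have "C \<inter> D = cylinder k z (max n m)"
          by (auto simp: CD cylinder_def less_max_iff_disj)
        then show ?thesis by blast
      qed
    qed
    show "emeasure \<mu> C = emeasure \<nu> C" if "C \<in> ?E" for C
    proof -
      from that obtain x n where C: "C = cylinder k x n" by blast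
      have "C \<subseteq> symb_space k" by (auto simp: C cylinder_def)
      then have "measure \<mu> C = measure \<nu> C"
        using eq[OF continuous_map_indicator_cylinder, of x n]
        by (simp add: C[symmetric] borel_prob_space[OF \<mu>] borel_prob_space[OF \<nu>] Int_absorb2)
      then show ?thesis
        by (simp add: \<mu>.emeasure_eq_measure \<nu>.emeasure_eq_measure)
    qed
    have "symb_space k = cylinder k undefined 0" by (simp add: cylinder_def)
    then show "range (\<lambda>_. symb_space k) \<subseteq> ?E" by blast
  qed (use \<mu> \<nu> sigma in \<open>auto simp: borel_prob_def cylinder_def\<close>)
qed

lemma integral_empirical_measure:
  assumes T: "\<And>i. (T ^^ i) x \<in> symb_space k" and f: "f \<in> borel_measurable (symb_borel k)"
    and "0 < n"
  shows "integral\<^sup>L (empirical_measure k T x n) f = (\<Sum>i<n. f ((T ^^ i) x)) / real n"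
proof -
  have "(\<lambda>i. (T ^^ i) x) \<in> measurable (uniform_count_measure {..<n}) (symb_borel k)"
    using T by (auto simp: measurable_def uniform_count_measure_def sets_point_measure space_point_measure)
  then have "integral\<^sup>L (empirical_measure k T x n) f
      = integral\<^sup>L (uniform_count_measure {..<n}) (\<lambda>i. f ((T ^^ i) x))"
    unfolding empirical_measure_def using f by (rule integral_distr)
  also have "\<dots> = (\<Sum>i<n. f ((T ^^ i) x)) / real n"
    unfolding uniform_count_measure_def
    by (subst lebesgue_integral_point_measure_finite)
      (simp_all add: sum_divide_distrib)
  finally show ?thesis .
qed

section \<open>Averages of shifted sequences and recurrence of letters\<close>

lemma cesaro_shift_iff:
  fixes a :: "nat \<Rightarrow> real"
  shows "(\<lambda>n. (\<Sum>i<n. a (m + i)) / real n) \<longlonglongrightarrow> G \<longleftrightarrow> (\<lambda>n. (\<Sum>i<n. a i) / real n) \<longlonglongrightarrow> G"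
proof -
  let ?C = "\<Sum>i<m. a i"
  have const: "(\<lambda>n. ?C / real n) \<longlonglongrightarrow> 0" "(\<lambda>n. ?C / real (m + n)) \<longlonglongrightarrow> 0"
    using lim_const_over_n[of ?C] LIMSEQ_ignore_initial_segment[OF lim_const_over_n[of ?C], of m]
    by (simp_all add: add.commute)
  have ratio: "(\<lambda>n. real (m + n) / real n) \<longlonglongrightarrow> 1"
  proof (rule Lim_transform_eventually)
    show "(\<lambda>n. real m / real n + 1) \<longlonglongrightarrow> 1"
      using tendsto_add[OF lim_const_over_n tendsto_const] by fastforce
    show "\<forall>\<^sub>F n in sequentially. real m / real n + 1 = real (m + n) / real n"
      using eventually_gt_at_top[of 0] by eventually_elim (simp add: field_simps)
  qed
  then have ratio': "(\<lambda>n. real n / real (m + n)) \<longlonglongrightarrow> 1"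
    using tendsto_inverse[OF ratio] by (simp add: inverse_eq_divide)
  have "(\<lambda>n. (\<Sum>i<n. a i) / real n) \<longlonglongrightarrow> G \<longleftrightarrow> (\<lambda>n. (\<Sum>i<m + n. a i) / real (m + n)) \<longlonglongrightarrow> G"
    using LIMSEQ_ignore_initial_segment[of "\<lambda>n. (\<Sum>i<n. a i) / real n" G m]
      LIMSEQ_offset[of "\<lambda>n. (\<Sum>i<n. a i) / real n" m G] by (auto simp: add.commute)
  moreover have "(\<lambda>n. (\<Sum>i<m + n. a i) / real (m + n)) \<longlonglongrightarrow> G"
    if "(\<lambda>n. (\<Sum>i<n. a (m + i)) / real n) \<longlonglongrightarrow> G"
  proof (rule Lim_transform_eventually)
    show "(\<lambda>n. ?C / real (m + n) + (\<Sum>i<n. a (m + i)) / real n * (real n / real (m + n))) \<longlonglongrightarrow> G"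
      using tendsto_add[OF const(2) tendsto_mult[OF that ratio']] by simp
    show "\<forall>\<^sub>F n in sequentially. ?C / real (m + n) + (\<Sum>i<n. a (m + i)) / real n * (real n / real (m + n))
        = (\<Sum>i<m + n. a i) / real (m + n)"
      using eventually_gt_at_top[of 0]
      by eventually_elim (simp add: sum_lessThan_add add_divide_distrib)
  qed
  moreover have "(\<lambda>n. (\<Sum>i<n. a (m + i)) / real n) \<longlonglongrightarrow> G"
    if "(\<lambda>n. (\<Sum>i<m + n. a i) / real (m + n)) \<longlonglongrightarrow> G"
  proof (rule Lim_transform_eventually)
    show "(\<lambda>n. (\<Sum>i<m + n. a i) / real (m + n) * (real (m + n) / real n) - ?C / real n) \<longlonglongrightarrow> G"
      using tendsto_diff[OF tendsto_mult[OF that ratio] const(1)] by simp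
    show "\<forall>\<^sub>F n in sequentially. (\<Sum>i<m + n. a i) / real (m + n) * (real (m + n) / real n) - ?C / real n
        = (\<Sum>i<n. a (m + i)) / real n"
      using eventually_gt_at_top[of 0]
    proof eventually_elim
      case (elim n)
      have "x / real (m + n) * (real (m + n) / real n) - ?C / real n = (x - ?C) / real n" for x
        using elim by (simp add: diff_divide_distrib del: of_nat_add)
      then show ?case
        by (simp add: sum_lessThan_add del: of_nat_add)
    qed
  qed
  ultimately show ?thesis by blast
qed

text \<open>\<open>N j\<close> collects the points without the letter \<open>a\<close> from position
  \<open>j\<close> on. Invariance gives all \<open>N j\<close> the same measure, and their
  increasing union is an invariant set, so this measure is 0 or 1. It is not 1, because full support
  gives positive measure to the open set \<open>P 0\<close>, which \<open>N 0\<close>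
  misses.\<close>

lemma shift_ergodic_letter_recurrent:
  assumes m: "shift_ergodic k m" and supp: "measure_support (symb_topology k) m = symb_space k"
    and "a < k"
  shows "AE x in m. \<forall>n. \<exists>i\<ge>n. x i = a"
proof -
  interpret prob_space m using m by (simp add: shift_ergodic_def borel_prob_def)
  have m': "borel_prob k m" using m by (simp add: shift_ergodic_def)
  have sets: "sets m = sets (symb_borel k)" using m' by (simp add: borel_prob_def)
  have space: "space m = symb_space k" by (rule borel_prob_space[OF m'])
  have inv: "shift \<in> measurable m m" "distr m m shift = m"
    using m by (simp_all add: shift_ergodic_def ergodic_measure_def invariant_measure_def)
  define P where "P i = {x \<in> symb_space k. x i = a}" for i
  have open_P: "openin (symb_topology k) (P i)" for i
  proof -
    have "cylinder k x (Suc i) \<subseteq> P i" if "x \<in> P i" for x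
      using that by (auto simp: P_def cylinder_def)
    then show ?thesis
      unfolding openin_symb_topology_iff by (auto simp: P_def)
  qed
  have P: "P i \<in> sets m" for i
    unfolding sets by (rule openin_sets_symb_borel[OF open_P])
  define N where "N j = space m - (\<Union>i\<in>{j..}. P i)" for j
  have N_sets: "N j \<in> sets m" for j
    unfolding N_def using P by auto
  have N_iff: "x \<in> N j \<longleftrightarrow> x \<in> symb_space k \<and> (\<forall>i\<ge>j. x i \<noteq> a)" for x j
    by (auto simp: N_def P_def space)
  have shift_space: "shift x \<in> symb_space k" if "x \<in> symb_space k" for x
    using that by (simp add: shift_def symb_space_def)
  have shift_N: "shift -` N j \<inter> space m = N (Suc j)" for j
  proof -
    have iff: "(\<forall>i\<ge>Suc j. x i \<noteq> a) \<longleftrightarrow> (\<forall>i\<ge>j. shift x i \<noteq> a)" for x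
      unfolding shift_def by (metis Suc_le_D Suc_le_mono)
    show ?thesis
      unfolding set_eq_iff vimage_eq Int_iff N_iff space iff using shift_space by blast
  qed
  have measure_N: "measure m (N j) = measure m (N 0)" for j
  proof (induction j)
    case (Suc j)
    have "measure m (N j) = measure (distr m m shift) (N j)" by (simp add: inv)
    also have "\<dots> = measure m (N (Suc j))"
      by (subst measure_distr[OF inv(1) N_sets]) (simp add: shift_N)
    finally show ?case using Suc by simp
  qed simp
  have mono_N: "N i \<subseteq> N j" if "i \<le> j" for i j
    using that by (auto simp: N_iff)
  have "(\<lambda>j. measure m (N j)) \<longlonglongrightarrow> measure m (\<Union>j. N j)"
    using N_sets mono_N by (intro finite_Lim_measure_incseq) (auto simp: incseq_def)
  moreover have "(\<lambda>j. measure m (N j)) = (\<lambda>_. measure m (N 0))"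
    by (rule ext) (rule measure_N)
  ultimately have union: "measure m (\<Union>j. N j) = measure m (N 0)"
    by (metis LIMSEQ_const_iff)
  have union_sets: "(\<Union>j. N j) \<in> sets m"
    using N_sets by blast
  \<comment> \<open>Ergodicity is stated for exactly invariant sets; taking preimages only moves the
    index, which the union absorbs.\<close>
  have "shift -` (\<Union>j. N j) \<inter> space m = (\<Union>j. N (Suc j))"
    using shift_N by blast
  also have "\<dots> = (\<Union>j. N j)"
  proof
    show "(\<Union>j. N (Suc j)) \<subseteq> (\<Union>j. N j)" by blast
    show "(\<Union>j. N j) \<subseteq> (\<Union>j. N (Suc j))"
      by (rule UN_mono) (use mono_N in auto)
  qed
  finally have "measure m (\<Union>j. N j) = 0 \<or> measure m (\<Union>j. N j) = 1"
    using m union_sets unfolding shift_ergodic_def ergodic_measure_def by blast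
  moreover have "measure m (N 0) \<noteq> 1"
  proof
    assume "measure m (N 0) = 1"
    then have "prob (space m - N 0) = 0"
      using N_sets by (simp add: prob_compl)
    moreover have "P 0 \<subseteq> space m - N 0"
      by (auto simp: P_def N_iff space)
    ultimately have "prob (P 0) = 0"
      using N_sets by (metis finite_measure_mono measure_nonneg order_antisym sets.compl_sets)
    then have "emeasure m (P 0) = 0" by (simp add: emeasure_eq_measure)
    moreover have "(\<lambda>_. a) \<in> measure_support (symb_topology k) m"
      using \<open>a < k\<close> by (simp add: supp symb_space_def)
    then have "0 < emeasure m (P 0)"
      using open_P[of 0] \<open>a < k\<close> by (auto simp: measure_support_def P_def symb_space_def)
    ultimately show False by simp
  qed
  ultimately have "prob (\<Union>j. N j) = 0" using union by auto
  then have "(\<Union>j. N j) \<in> null_sets m"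
    using N_sets by (auto simp: null_sets_def emeasure_eq_measure)
  then have "AE x in m. x \<notin> (\<Union>j. N j)" by (rule AE_not_in)
  then show ?thesis
    by (rule AE_mp) (auto simp: N_iff space)
qed

section \<open>The attractor\<close>

lemma counter_in_symb_space: "counter p \<in> symb_space 4"
  by (simp add: counter_def symb_space_def)

lemma spike_in_symb_space: "spike c \<in> symb_space 4"
  by (simp add: spike_def symb_space_def)

lemma word_state_in_symb_space: "word_state c l p \<in> symb_space 4"
  using spike_in_symb_space[of c] counter_in_symb_space[of p]
  by (simp add: word_state_def symb_space_def)

lemma new_phase_in_symb_space: "new_phase p \<in> symb_space 4"
  using word_state_in_symb_space by (simp add: new_phase_def symb_space_def)

lemma attractor_map_in_symb_space: "x \<in> symb_space 4 \<Longrightarrow> attractor_map x \<in> symb_space 4"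
  using new_phase_in_symb_space by (simp add: attractor_map_def symb_space_def)

lemma funpow_attractor_map_in_symb_space:
  "x \<in> symb_space 4 \<Longrightarrow> (attractor_map ^^ i) x \<in> symb_space 4"
  by (induction i) (simp_all add: attractor_map_in_symb_space)

text \<open>This locality yields both measurability and the modulus \<open>Suc\<close> of
  computability.\<close>

lemma attractor_map_local:
  assumes "\<And>j. j \<le> Suc i \<Longrightarrow> x j = y j"
  shows "attractor_map x i = attractor_map y i"
proof -
  have "(\<lambda>k. x (Suc k) \<noteq> 2 \<or> i < k) = (\<lambda>k. y (Suc k) \<noteq> 2 \<or> i < k)"
    using assms by (force simp: fun_eq_iff not_less)
  moreover have "(\<exists>k<i + 2. x k = 3) \<longleftrightarrow> (\<exists>k<i + 2. y k = 3)"
    using assms by (auto simp: less_Suc_eq_le)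
  moreover have "x 0 = y 0" "x i = y i" "x (Suc i) = y (Suc i)"
    using assms by simp_all
  ultimately show ?thesis
    by (simp only: attractor_map_def)
qed

lemma attractor_map_measurable: "attractor_map \<in> measurable (symb_borel 4) (symb_borel 4)"
proof -
  have "attractor_map -` U \<inter> symb_space 4 \<in> sets (symb_borel 4)" if U: "openin (symb_topology 4) U" for U
  proof (rule openin_sets_symb_borel)
    show "openin (symb_topology 4) (attractor_map -` U \<inter> symb_space 4)"
      unfolding openin_symb_topology_iff
    proof (intro conjI ballI)
      fix x assume "x \<in> attractor_map -` U \<inter> symb_space 4"
      then obtain n where n: "cylinder 4 (attractor_map x) n \<subseteq> U"
        using U unfolding openin_symb_topology_iff by blast
      have "cylinder 4 x (Suc n) \<subseteq> attractor_map -` U \<inter> symb_space 4"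
      proof
        fix y assume y: "y \<in> cylinder 4 x (Suc n)"
        then have "attractor_map y i = attractor_map x i" if "i < n" for i
          using that by (intro attractor_map_local) (simp add: cylinder_def)
        moreover have "y \<in> symb_space 4" using y by (simp add: cylinder_def)
        ultimately have "attractor_map y \<in> cylinder 4 (attractor_map x) n"
          by (simp add: cylinder_def attractor_map_in_symb_space)
        with n \<open>y \<in> symb_space 4\<close> show "y \<in> attractor_map -` U \<inter> symb_space 4" by blast
      qed
      then show "\<exists>n. cylinder 4 x n \<subseteq> attractor_map -` U \<inter> symb_space 4" by blast
    qed simp
  qed
  then show ?thesis
    unfolding symb_borel_def[of 4]
    by (intro measurable_measure_of)
      (use openin_subset attractor_map_in_symb_space in
        \<open>fastforce simp: symb_borel_def[symmetric]\<close>)+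
qed

lemma computable_phase_code [cintro]: "computable f \<Longrightarrow> computable (\<lambda>n. phase_code (f n))"
  unfolding phase_code_def
  subgoal premises f by (intro cintro f computable_comp[OF f])
  done

lemma computable_phase_length [cintro]: "computable f \<Longrightarrow> computable (\<lambda>n. phase_length (f n))"
  unfolding phase_length_def by (intro cintro)

lemma computable_new_phase [cintro]:
  "computable f \<Longrightarrow> computable g \<Longrightarrow> computable (\<lambda>n. new_phase (f n) (g n))"
  unfolding new_phase_def word_state_def spike_def counter_def by (intro cintro)

lemma computable_map_attractor_map: "computable_map 4 attractor_map"
proof -
  \<comment> \<open>\<open>nth_code (psnd w)\<close> turns the finite prefix into an infinite
    sequence, on which the map itself is evaluated; by locality the first \<open>n\<close> letters
    of the result come from the \<open>n + 1\<close> given ones.\<close>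
  define h where "h w = list_encode (map (attractor_map (nth_code (psnd w))) [0..<pfst w])" for w
  have "computable h"
    unfolding h_def attractor_map_def by (intro cintro) (auto intro: exI[of _ "Suc n" for n])
  moreover have "h (prod_encode (n, list_encode (map x [0..<Suc n]))) = list_encode (map (attractor_map x) [0..<n])"
    for x n
  proof -
    have "attractor_map (nth_code (list_encode (map x [0..<Suc n]))) i = attractor_map x i" if "i < n" for i
      using that by (intro attractor_map_local) (simp del: upt_Suc)
    then have "map (attractor_map (nth_code (list_encode (map x [0..<Suc n])))) [0..<n]
        = map (attractor_map x) [0..<n]"
      by (intro map_cong refl) simp
    then show ?thesis
      by (simp only: h_def prod_encode_inverse fst_conv snd_conv)
  qed
  ultimately have "mono Suc \<and> computable Suc \<and> partial_recursive (\<lambda>w. Some (h w)) \<and>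
    (\<forall>x\<in>symb_space 4. \<forall>n. Some (h (prod_encode (n, list_encode (map x [0..<Suc n]))))
      = Some (list_encode (map (attractor_map x) [0..<n])))"
    by (auto simp: mono_def computable_def partial_recursive.succ simp del: upt_Suc)
  then show ?thesis
    unfolding computable_map_def using attractor_map_in_symb_space by blast
qed

section \<open>The attractor and its closedness\<close>

definition attractor :: "(nat \<Rightarrow> nat) set" where
  "attractor = range (\<lambda>e. spike (limit_code e))"

lemma limit_code_0: "limit_code 0 = 0"
  using not_alive_0 by (simp add: limit_code_def)

text \<open>The zero sequence is the only accumulation point of the spikes. Any other point has a
  letter \<open>x l \<noteq> 0\<close>, which among the spikes only \<open>spike (Suc l)\<close> can
  match, so a finite prefix separates it from the set.\<close>

lemma closedin_spikes:
  assumes "0 \<in> C"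
  shows "closedin (symb_topology 4) (spike ` C)"
proof -
  have "\<exists>n. cylinder 4 x n \<subseteq> symb_space 4 - spike ` C" if x: "x \<in> symb_space 4 - spike ` C" for x
  proof -
    have "x \<noteq> spike 0" using x assms by blast
    then obtain l where l: "x l \<noteq> 0" by (auto simp: spike_def)
    have only: "c = Suc l" if "spike c l \<noteq> 0" for c
      using that by (simp add: spike_def split: if_splits)
    show ?thesis
    proof (cases "Suc l \<in> C")
      case True
      with x have "x \<noteq> spike (Suc l)" by blast
      then obtain l' where l': "x l' \<noteq> spike (Suc l) l'" by blast
      have "cylinder 4 x (max (Suc l) (Suc l')) \<inter> spike ` C = {}"
      proof (rule ccontr)
        assume "cylinder 4 x (max (Suc l) (Suc l')) \<inter> spike ` C \<noteq> {}"
        then obtain c where "\<forall>i<max (Suc l) (Suc l'). spike c i = x i"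
          by (auto simp: cylinder_def)
        then have "spike c l = x l" "spike c l' = x l'" by simp_all
        with l l' only[of c] show False by simp
      qed
      then show ?thesis by (intro exI[of _ "max (Suc l) (Suc l')"]) (auto simp: cylinder_def)
    next
      case False
      have "cylinder 4 x (Suc l) \<inter> spike ` C = {}"
      proof (rule ccontr)
        assume "cylinder 4 x (Suc l) \<inter> spike ` C \<noteq> {}"
        then obtain c where "spike c l = x l" "c \<in> C"
          by (auto simp: cylinder_def)
        with l False only[of c] show False by simp
      qed
      then show ?thesis by (intro exI[of _ "Suc l"]) (auto simp: cylinder_def)
    qed
  qed
  then show ?thesis
    unfolding closedin_def openin_symb_topology_iff using spike_in_symb_space by auto
qed

lemma closedin_attractor: "closedin (symb_topology 4) attractor"
proof -
  have "0 \<in> range limit_code" using limit_code_0 by (metis rangeI)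
  from closedin_spikes[OF this] show ?thesis
    by (simp add: attractor_def image_image)
qed

section \<open>Sigma-2-completeness of the attractor\<close>

definition in_ball :: "nat \<Rightarrow> nat \<Rightarrow> bool" where
  "in_ball i c \<longleftrightarrow> (\<forall>l<Suc (plast i). Suc (pmid i) * 2 ^ l \<le> Suc (plast i) \<longrightarrow>
     (if l < length_code (pfst i) then nth_code (pfst i) l mod 4 else 0) = (if Suc l = c then 1 else 0))"

text \<open>The radius condition becomes \<open>(p + 1) * 2^l \<le> q + 1\<close> in integers. It
  forces \<open>l \<le> q\<close> because of \<open>l < 2^l\<close>, which bounds the quantifier and
  makes membership decidable.\<close>

lemma spike_in_ideal_ball_iff: "spike c \<in> ideal_ball 4 i \<longleftrightarrow> in_ball i c"
proof -
  let ?p = "pmid i" and ?q = "plast i" and ?w = "map (\<lambda>m. m mod 4) (list_decode (pfst i))"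
  have w: "ideal_point ?w \<in> symb_space 4"
    by (simp add: ideal_point_def symb_space_def)
  have w_nth: "ideal_point ?w l = (if l < length_code (pfst i) then nth_code (pfst i) l mod 4 else 0)" for l
    using length_code_list_encode[of "list_decode (pfst i)"] nth_code_list_encode[of l "list_decode (pfst i)"]
    by (simp add: ideal_point_def)
  have radius: "real (Suc ?p) / real (Suc ?q) \<le> inverse (2 ^ l) \<longleftrightarrow> Suc ?p * 2 ^ l \<le> Suc ?q" for l
  proof -
    have "real (Suc ?p) / real (Suc ?q) \<le> inverse (2 ^ l) \<longleftrightarrow> real (Suc ?p) * 2 ^ l \<le> real (Suc ?q)"
    proof -
      have "a / b \<le> inverse c \<longleftrightarrow> a * c \<le> b" if "0 < b" "0 < c" for a b c :: real
        using that by (simp add: field_simps)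
      then show ?thesis by (simp del: of_nat_Suc)
    qed
    also have "\<dots> \<longleftrightarrow> real (Suc ?p * 2 ^ l) \<le> real (Suc ?q)"
      by (simp only: of_nat_mult of_nat_power of_nat_numeral)
    finally show ?thesis by (simp only: of_nat_le_iff)
  qed
  have "l < Suc ?q" if "Suc ?p * 2 ^ l \<le> Suc ?q" for l
  proof -
    have "l < 2 ^ l" by (rule less_exp)
    also have "\<dots> \<le> Suc ?p * 2 ^ l" by simp
    finally show ?thesis using that by simp
  qed
  moreover have "spike c \<in> ideal_ball 4 i \<longleftrightarrow>
      (\<forall>l. Suc ?p * 2 ^ l \<le> Suc ?q \<longrightarrow> ideal_point ?w l = spike c l)"
    using w spike_in_symb_space
    by (simp add: ideal_ball_def split_beta symb_dist_less_iff radius del: of_nat_Suc)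
  ultimately show ?thesis
    unfolding in_ball_def w_nth spike_def by blast
qed

lemma computable_pred_in_ball [cintro]:
  assumes "computable f" "computable g"
  shows "computable_pred (\<lambda>n. in_ball (f n) (g n))"
  unfolding in_ball_def by (intro cintro assms computable_comp[OF assms(1)] computable_comp[OF assms(2)])

lemma inner_collection_attractor:
  "inner_collection 4 attractor = {i. \<exists>e. in_ball i (limit_code e)}"
  by (auto simp: inner_collection_def attractor_def spike_in_ideal_ball_iff[symmetric])

text \<open>A guess \<open>e\<close> contributes \<open>0^\<infinity>\<close> or, if it stays alive,
  the spike at \<open>pfst e\<close>. Since \<open>0^\<infinity>\<close> belongs to the attractor
  anyway, balls containing it are accepted at once; for all others only the Pi-1 condition of
  staying alive is left.\<close>

lemma Sigma_compact_attractor: "Sigma_compact 2 4 attractor"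
proof -
  define D where "D = {v. in_ball (pfst (pfst v)) 0 \<or> (alive (psnd (pfst v)) (psnd v) \<and>
    in_ball (pfst (pfst v)) (Suc (pfst (psnd (pfst v)))))}"
  have "computable_pred (\<lambda>v. v \<in> D)"
    unfolding D_def mem_Collect_eq by (intro cintro)
  then have "decidable D"
    by (simp add: decidable_def computable_pred_def)
  moreover have "inner_collection 4 attractor = {i. \<exists>y. \<forall>z. prod_encode (prod_encode (i, y), z) \<in> D}"
  proof -
    have "(\<exists>e. in_ball i (limit_code e)) \<longleftrightarrow>
        (\<exists>y. \<forall>z. in_ball i 0 \<or> alive y z \<and> in_ball i (Suc (pfst y)))" for i
    proof (cases "in_ball i 0")
      case True
      then have "in_ball i (limit_code 0)" by (simp add: limit_code_0)
      with True show ?thesis by blast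
    qed (auto simp: limit_code_def)
    then show ?thesis
      by (simp add: inner_collection_attractor D_def)
  qed
  ultimately have "Sigma_set 2 (inner_collection 4 attractor)"
    unfolding numeral_2_eq_2 Sigma_set.simps
    by (intro exI[of _ "{w. \<exists>z. prod_encode (w, z) \<notin> D}"] conjI exI[of _ D]) simp_all
  moreover have "compactin (symb_topology 4) attractor"
    by (rule closedin_compact_space[OF compact_space_symb_topology closedin_attractor])
  ultimately show ?thesis
    by (simp add: Sigma_compact_def)
qed

text \<open>Center \<open>0^j 1 0^\<infinity>\<close> and radius \<open>2^-j\<close>, coded by the
  numbers 0 and \<open>2^j - 1\<close>. The ball fixes the letters up to position \<open>j\<close>,
  so it contains a single spike.\<close>

definition spike_ball :: "nat \<Rightarrow> nat" where
  "spike_ball j = triple (list_encode (map (\<lambda>i. if i = j then 1 else 0) [0..<Suc j])) 0 (2 ^ j - 1)"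

lemma computable_spike_ball [cintro]:
  assumes "computable f"
  shows "computable (\<lambda>n. spike_ball (f n))"
  unfolding spike_ball_def by (intro cintro assms computable_comp[OF assms])

lemma in_ball_spike_ball: "in_ball (spike_ball j) c \<longleftrightarrow> c = Suc j"
proof -
  have "in_ball (spike_ball j) c \<longleftrightarrow>
      (\<forall>l<2 ^ j. l \<le> j \<longrightarrow> (if l = j then 1 else 0) = (if Suc l = c then 1 else (0::nat)))"
    by (auto simp: in_ball_def spike_ball_def less_Suc_eq_le simp del: upt_Suc)
  also have "\<dots> \<longleftrightarrow> c = Suc j"
    using less_exp[of j] by (auto split: if_splits)
  finally show ?thesis .
qed

lemma spike_ball_in_inner_collection:
  "spike_ball j \<in> inner_collection 4 attractor \<longleftrightarrow> (\<exists>y. \<forall>z. alive (prod_encode (j, y)) z)"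
proof -
  have "spike_ball j \<in> inner_collection 4 attractor \<longleftrightarrow> (\<exists>e. (\<forall>z. alive e z) \<and> pfst e = j)"
    by (auto simp: inner_collection_attractor in_ball_spike_ball limit_code_def split: if_splits)
  also have "\<dots> \<longleftrightarrow> (\<exists>y. \<forall>z. alive (prod_encode (j, y)) z)"
    by (metis prod_decode_inverse prod_encode_inverse prod.collapse fst_conv)
  finally show ?thesis .
qed

text \<open>The function \<open>spike_ball (g a)\<close> of \<open>a\<close> is a many-one
  reduction. The new enumeration runs through all pairs of a candidate \<open>a\<close> and a
  position in the given enumeration.\<close>

lemma Sigma_complete_attractor: "Sigma_complete 2 4 attractor"
  unfolding Sigma_complete_def
proof (intro conjI allI impI Sigma_compact_attractor)
  fix K assume "Sigma_compact 2 4 K"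
  then have "Sigma_set 2 (inner_collection 4 K)"
    by (simp add: Sigma_compact_def)
  from Sigma_2_universal[OF this] obtain g where g: "computable g"
    and "\<And>a. a \<in> inner_collection 4 K \<longleftrightarrow> (\<exists>y. \<forall>z. alive (prod_encode (g a, y)) z)" by blast
  then have red: "\<And>a. a \<in> inner_collection 4 K \<longleftrightarrow> spike_ball (g a) \<in> inner_collection 4 attractor"
    by (simp add: spike_ball_in_inner_collection)
  \<comment> \<open>Stage \<open>t = (a, k + 1)\<close> outputs \<open>a\<close> if value number
    \<open>k\<close> of the given enumeration announces the ball for \<open>a\<close>. Storing
    \<open>k + 1\<close> ensures \<open>k < t\<close>, so this value is among the first
    \<open>t\<close>.\<close>
  define h where "h L = (if psnd (length_code L) - 1 < length_code L \<and>
      nth_code L (psnd (length_code L) - 1) = Suc (spike_ball (g (pfst (length_code L))))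
    then Suc (pfst (length_code L)) else 0)" for L
  have "computable h"
    unfolding h_def by (intro cintro computable_comp[OF g])
  moreover have "enumerates (\<lambda>t. h (list_encode (map f [0..<t]))) (inner_collection 4 K)"
    if f: "enumerates f (inner_collection 4 attractor)" for f
  proof -
    have h: "h (list_encode (map f [0..<t])) = (if psnd t - 1 < t \<and> f (psnd t - 1) = Suc (spike_ball (g (pfst t)))
        then Suc (pfst t) else 0)" for t
      by (auto simp: h_def)
    have "a \<in> inner_collection 4 K \<longleftrightarrow> (\<exists>t. h (list_encode (map f [0..<t])) = Suc a)" for a
    proof
      assume "a \<in> inner_collection 4 K"
      then obtain k where k: "f k = Suc (spike_ball (g a))"
        using red f unfolding enumerates_def by blast
      have "k < prod_encode (a, Suc k)"
        using le_prod_encode_2[of "Suc k" a] by simp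
      with k have "h (list_encode (map f [0..<prod_encode (a, Suc k)])) = Suc a"
        by (simp add: h)
      then show "\<exists>t. h (list_encode (map f [0..<t])) = Suc a" ..
    next
      assume "\<exists>t. h (list_encode (map f [0..<t])) = Suc a"
      then obtain k where "f k = Suc (spike_ball (g a))"
        by (auto simp: h split: if_splits)
      then show "a \<in> inner_collection 4 K"
        using red f unfolding enumerates_def by blast
    qed
    then show ?thesis by (auto simp: enumerates_def)
  qed
  ultimately show "enumeration_reducible (inner_collection 4 K) (inner_collection 4 attractor)"
    unfolding enumeration_reducible_def by blast
qed

section \<open>The limit measure\<close>

definition attractor_measure :: "(nat \<Rightarrow> nat) measure" where
  "attractor_measure = distr (measure_pmf (geometric_pmf (1/2))) (symb_borel 4) (\<lambda>e. spike (limit_code e))"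

lemma measurable_limit_spike:
  "(\<lambda>e. spike (limit_code e)) \<in> measurable (measure_pmf p) (symb_borel 4)"
  by (simp add: spike_in_symb_space)

lemma borel_prob_attractor_measure: "borel_prob 4 attractor_measure"
  unfolding borel_prob_def attractor_measure_def
  using measure_pmf.prob_space_distr[OF measurable_limit_spike] by simp

text \<open>The measure is carried by spikes, all of which are fixed points.\<close>

lemma invariant_attractor_measure: "invariant_measure attractor_map attractor_measure"
proof -
  have "attractor_map \<in> measurable attractor_measure attractor_measure"
    using attractor_map_measurable by (simp add: attractor_measure_def)
  moreover have "distr attractor_measure attractor_measure attractor_map = attractor_measure"
  proof -
    have "distr attractor_measure attractor_measure attractor_map
        = distr attractor_measure (symb_borel 4) attractor_map"
      by (rule distr_cong) (simp_all add: attractor_measure_def)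
    also have "\<dots> = distr (measure_pmf (geometric_pmf (1/2))) (symb_borel 4)
        (attractor_map \<circ> (\<lambda>e. spike (limit_code e)))"
      unfolding attractor_measure_def
      by (rule distr_distr[OF attractor_map_measurable measurable_limit_spike])
    also have "\<dots> = attractor_measure"
      by (simp add: attractor_measure_def comp_def attractor_map_spike)
    finally show ?thesis .
  qed
  ultimately show ?thesis by (simp add: invariant_measure_def)
qed

text \<open>The geometric distribution gives positive mass to each guess, so an open null set avoids
  every spike of the attractor. Together with closedness this determines the support.\<close>

lemma emeasure_attractor_measure_pos_iff:
  assumes "openin (symb_topology 4) U"
  shows "0 < emeasure attractor_measure U \<longleftrightarrow> U \<inter> attractor \<noteq> {}"
proof -
  have "emeasure attractor_measure U = emeasure (measure_pmf (geometric_pmf (1/2))) {e. spike (limit_code e) \<in> U}"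
    unfolding attractor_measure_def
    by (subst emeasure_distr[OF measurable_limit_spike openin_sets_symb_borel[OF assms]]) (simp add: vimage_def)
  moreover have "emeasure (measure_pmf (geometric_pmf (1/2))) E = 0 \<longleftrightarrow> E = {}" for E
    by (simp add: measure_pmf.emeasure_eq_measure measure_pmf_zero_iff set_pmf_geometric)
  ultimately show ?thesis
    by (auto simp: zero_less_iff_neq_zero attractor_def)
qed

lemma support_attractor_measure: "measure_support (symb_topology 4) attractor_measure = attractor"
proof
  show "measure_support (symb_topology 4) attractor_measure \<subseteq> attractor"
  proof
    fix x assume x: "x \<in> measure_support (symb_topology 4) attractor_measure"
    show "x \<in> attractor"
    proof (rule ccontr)
      assume "x \<notin> attractor"
      let ?U = "symb_space 4 - attractor"
      have U: "openin (symb_topology 4) ?U"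
        using closedin_attractor by (simp add: closedin_def)
      with x \<open>x \<notin> attractor\<close> have "0 < emeasure attractor_measure ?U"
        by (simp add: measure_support_def)
      then show False
        unfolding emeasure_attractor_measure_pos_iff[OF U] by blast
    qed
  qed
  show "attractor \<subseteq> measure_support (symb_topology 4) attractor_measure"
    using emeasure_attractor_measure_pos_iff spike_in_symb_space
    by (auto simp: measure_support_def attractor_def)
qed

text \<open>The mass of \<open>e\<close> under \<open>geometric_pmf (1/2)\<close> is
  \<open>(1/2)^e / 2\<close>, which matches the limit of the time averages.\<close>

lemma integral_attractor_measure:
  assumes f: "continuous_map (symb_topology 4) euclideanreal f"
  shows "integral\<^sup>L attractor_measure f = (\<Sum>e. (1/2) ^ e * f (spike (limit_code e))) / 2"
proof -
  let ?g = "\<lambda>e. f (spike (limit_code e))" and ?p = "geometric_pmf (1/2)"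
  have "integrable (measure_pmf ?p) ?g"
    using continuous_map_symb_integrable[OF f borel_prob_attractor_measure]
      continuous_map_symb_measurable[OF f]
    unfolding attractor_measure_def by (subst (asm) integrable_distr_eq[OF measurable_limit_spike])
  then have int: "integrable (count_space UNIV) (\<lambda>e. pmf ?p e * ?g e)"
    unfolding measure_pmf_eq_density by (subst (asm) integrable_density) simp_all
  have "integral\<^sup>L attractor_measure f = integral\<^sup>L (measure_pmf ?p) ?g"
    unfolding attractor_measure_def
    by (rule integral_distr[OF measurable_limit_spike continuous_map_symb_measurable[OF f]])
  also have "\<dots> = integral\<^sup>L (count_space UNIV) (\<lambda>e. pmf ?p e * ?g e)"
    unfolding measure_pmf_eq_density by (subst integral_density) simp_all
  also have "\<dots> = (\<Sum>e. pmf ?p e * ?g e)"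
    by (rule integral_count_space_nat[OF int])
  also have "\<dots> = (\<Sum>e. (1/2) ^ e * ?g e / 2)"
    by (simp add: pmf_geometric)
  also have "\<dots> = (\<Sum>e. (1/2) ^ e * ?g e) / 2"
  proof (rule suminf_divide)
    have "summable (\<lambda>e. 2 * (pmf ?p e * ?g e))"
      using int by (intro summable_mult) (simp add: integrable_count_space_nat_iff summable_rabs_cancel)
    then show "summable (\<lambda>e. (1/2) ^ e * ?g e)"
      by (simp add: pmf_geometric)
  qed
  finally show ?thesis .
qed

section \<open>Convergence of the empirical measures\<close>

lemma test_function_continuous_map:
  assumes f: "continuous_map (symb_topology 4) euclideanreal f"
  shows "\<exists>B. test_function f B"
proof -
  obtain B where B: "\<And>x. x \<in> symb_space 4 \<Longrightarrow> \<bar>f x\<bar> \<le> B"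
    using continuous_map_symb_bounded[OF f] by blast
  have "test_function f B"
  proof
    fix c :: nat and \<epsilon> :: real
    assume "0 < \<epsilon>"
    then obtain n where n: "\<And>y. y \<in> cylinder 4 (spike c) n \<Longrightarrow> \<bar>f y - f (spike c)\<bar> < \<epsilon>"
      using continuous_map_symb_near[OF f spike_in_symb_space] by blast
    \<comment> \<open>The first \<open>l\<close> letters are those of the spike for every counter
      \<open>p\<close>, hence the uniformity.\<close>
    have "word_state c l p \<in> cylinder 4 (spike c) n" if "n \<le> l" for l p
      using that word_state_in_symb_space by (simp add: cylinder_def) (simp add: word_state_def)
    with n show "\<exists>N. \<forall>l\<ge>N. \<forall>p. \<bar>f (word_state c l p) - f (spike c)\<bar> \<le> \<epsilon>"
      by (meson less_imp_le)
  qed (intro B funpow_attractor_map_in_symb_space counter_in_symb_space spike_in_symb_space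
      word_state_in_symb_space)+
  then show ?thesis ..
qed

lemma weak_star_limit_orbit:
  assumes x: "x \<in> symb_space 4" and inf: "\<And>n. \<exists>i\<ge>n. x i = 3"
  shows "weak_star_limit (symb_topology 4) (empirical_measure 4 attractor_map x) attractor_measure"
  unfolding weak_star_limit_def
proof (intro allI impI)
  fix f :: "(nat \<Rightarrow> nat) \<Rightarrow> real"
  assume f: "continuous_map (symb_topology 4) euclideanreal f"
  let ?G = "integral\<^sup>L attractor_measure f"
  obtain B where "test_function f B" using test_function_continuous_map[OF f] by blast
  then have main: "(\<lambda>n. (\<Sum>i<n. f (main_orbit i)) / real n) \<longlonglongrightarrow> ?G"
    unfolding integral_attractor_measure[OF f] by (rule test_function.main_orbit_average)
  obtain n m where nm: "(attractor_map ^^ n) x = main_orbit m"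
    using orbit_merges[OF inf] by blast
  have "f ((attractor_map ^^ (n + i)) x) = f (main_orbit (m + i))" for i
    using nm by (simp add: add.commute[of _ i] funpow_add)
  then have "(\<lambda>k. (\<Sum>i<k. f ((attractor_map ^^ (n + i)) x)) / real k) \<longlonglongrightarrow> ?G"
    using cesaro_shift_iff[of "\<lambda>i. f (main_orbit i)" m ?G] main by simp
  then have "(\<lambda>k. (\<Sum>i<k. f ((attractor_map ^^ i) x)) / real k) \<longlonglongrightarrow> ?G"
    using cesaro_shift_iff[of "\<lambda>i. f ((attractor_map ^^ i) x)" n ?G] by simp
  then show "(\<lambda>n. integral\<^sup>L (empirical_measure 4 attractor_map x n) f) \<longlonglongrightarrow> ?G"
  proof (rule Lim_transform_eventually)
    show "\<forall>\<^sub>F n in sequentially. (\<Sum>i<n. f ((attractor_map ^^ i) x)) / real n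
        = integral\<^sup>L (empirical_measure 4 attractor_map x n) f"
      using eventually_gt_at_top[of 0]
      by eventually_elim
        (simp add: integral_empirical_measure funpow_attractor_map_in_symb_space[OF x]
          continuous_map_symb_measurable[OF f])
  qed
qed

lemma statistical_attractor_attractor:
  assumes m: "shift_ergodic 4 m" and supp: "measure_support (symb_topology 4) m = symb_space 4"
  shows "statistical_attractor 4 attractor_map m attractor"
proof -
  interpret prob_space m using m by (simp add: shift_ergodic_def borel_prob_def)
  have space: "space m = symb_space 4"
    using m by (simp add: shift_ergodic_def borel_prob_space)
  have "AE x in m. \<forall>n. \<exists>i\<ge>n. x i = 3"
    by (rule shift_ergodic_letter_recurrent[OF m supp]) simp
  then have AE: "AE x in m. weak_star_limit (symb_topology 4) (empirical_measure 4 attractor_map x) attractor_measure"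
    using AE_space
    by eventually_elim (simp add: space weak_star_limit_orbit)
  have "\<mu> = attractor_measure" if \<mu>: "borel_prob 4 \<mu>"
    and AE\<mu>: "AE x in m. weak_star_limit (symb_topology 4) (empirical_measure 4 attractor_map x) \<mu>" for \<mu>
  proof -
    \<comment> \<open>Two properties of probability one hold at a common point, where both measures
      are limits of the same empirical measures. Their integrals of continuous functions then agree,
      and these determine a measure.\<close>
    have "\<exists>x. weak_star_limit (symb_topology 4) (empirical_measure 4 attractor_map x) attractor_measure \<and>
        weak_star_limit (symb_topology 4) (empirical_measure 4 attractor_map x) \<mu>"
    proof (rule ccontr)
      assume none: "\<not> ?thesis"
      from AE AE\<mu> have "AE x in m. False"
        by eventually_elim (use none in blast)
      then show False by simp
    qed
    then show ?thesis
      using borel_prob_eqI[OF \<mu> borel_prob_attractor_measure] LIMSEQ_unique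
      unfolding weak_star_limit_def by meson
  qed
  with AE show ?thesis
    unfolding statistical_attractor_def
    using closedin_attractor borel_prob_attractor_measure invariant_attractor_measure
      support_attractor_measure by blast
qed

theorem theorem5:
  shows "\<exists>(k::nat) T A.
    k \<ge> 2 \<and>
    computable_map k T \<and>
    Sigma_complete 2 k A \<and>
    (\<forall>m. shift_ergodic k m \<and> measure_support (symb_topology k) m = symb_space k \<longrightarrow>
       statistical_attractor k T m A)"
proof (intro exI conjI allI impI)
  show "computable_map 4 attractor_map"
    by (rule computable_map_attractor_map)
  show "Sigma_complete 2 4 attractor"
    by (rule Sigma_complete_attractor)
qed (auto intro: statistical_attractor_attractor)

end
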